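(* Let $T,\Omega>0$. Let $\Lambda=\{\lambda_k\}_{k\in\mathbb{Z}}\subseteq\mathbb{R}$, $\lambda_{k+1}>\lambda_k$ for all $k$, be a set of sampling for $OPW([0,T]\times[-\frac{\Omega}{2},\frac{\Omega}{2}])$ and let $\{e^{-2\pi i\lambda_k\xi}\}_{k\in\mathbb{Z}}$ be a Riesz basis for $L^2[-\frac{\Omega}{2},\frac{\Omega}{2}]$. Then $\lambda_{k+1}-\lambda_k\geq T$ for all $k\in\mathbb{Z}$.
   Context: Hilbert-Schmidt operators: $HS(L^2(\mathbb{R}))$ is the space of operators $Hf(x)=\int\kappa_H(x,t)f(t)\,dt$ with kernel $\kappa_H\in L^2(\mathbb{R}^2)$, and $\|H\|_{HS}=\|\kappa_H\|_{L^2}$. The time-varying impulse response is $h_H(t,x)=\kappa_H(x,x-t)$, so that $Hf(x)=\int h_H(t,x)f(x-t)\,dt$, and the spreading function is $\eta_H(t,\nu)=\int h_H(t,x)e^{-2\pi i x\nu}\,dx$ (in the $L^2$ sense); it is the symplectic Fourier transform of the Kohn-Nirenberg symbol of $H$. For $S\subseteq\mathbb{R}^2$, $OPW(S)=\{H\in HS(L^2(\mathbb{R})): \operatorname{supp}\eta_H\subseteq S\}$. $S_0(\mathbb{R})$ is the Feichtinger algebra of $f\in L^2(\mathbb{R})$ with $V_gf(t,\nu)=\int f(x)\overline{e^{2\pi i\nu x}g(x-t)}\,dx\in L^1(\mathbb{R}^2)$, $g(x)=e^{-\pi x^2}$, normed by $\|V_gf\|_{L^1}$; $S_0'(\mathbb{R})$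 is its dual. For $S$ compact, every $H\in OPW(S)$ extends to a bounded operator $S_0'(\mathbb{R})\to L^2(\mathbb{R})$; on $f=\sum_k c_k\delta_{\lambda_k}$ it acts by $(Hf)(x)=\sum_k c_k\kappa_H(x,\lambda_k)=\sum_k c_kh_H(x-\lambda_k,x)$, where for a.e. $t$ the function $h_H(t,\cdot)$ is taken to be its continuous representative $x\mapsto\int\eta_H(t,\nu)e^{2\pi i x\nu}\,d\nu$. An element $f\in S_0'(\mathbb{R})$ identifies an operator class $\mathcal{H}$ if there are constants $c,C>0$ with $c\|H\|_{HS}\leq\|Hf\|_{L^2}\leq C\|H\|_{HS}$ for all $H\in\mathcal{H}$. A sequence $\Lambda=\{\lambda_k\}_{k\in\mathbb{Z}}$ is a set of sampling for $\mathcal{H}$ if for some $\{c_k\}\in\ell^\infty(\mathbb{Z})$ we have $\sum_k c_k\delta_{\lambda_k}\in S_0'(\mathbb{R})$ and $\sum_k c_k\delta_{\lambda_k}$ identifies $\mathcal{H}$. A Riesz basis of a Hilbert space is a frame that ceases to be a frame when any element is removed. *)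

theory Defs
  imports "HOL-Analysis.Analysis"
begin

section \<open>Square-integrable functions, frames and Riesz bases\<close>

definition Ltwo :: "'a measure \<Rightarrow> ('a \<Rightarrow> complex) set" where
  "Ltwo M = {f \<in> borel_measurable M. integrable M (\<lambda>x. (cmod (f x))\<^sup>2)}"

definition norm2 :: "'a measure \<Rightarrow> ('a \<Rightarrow> complex) \<Rightarrow> real" where
  "norm2 M f = sqrt (\<integral>x. (cmod (f x))\<^sup>2 \<partial>M)"

definition inner2 :: "'a measure \<Rightarrow> ('a \<Rightarrow> complex) \<Rightarrow> ('a \<Rightarrow> complex) \<Rightarrow> complex" where
  "inner2 M f g = (\<integral>x. f x * cnj (g x) \<partial>M)"

definition Ltwo_tendsto ::
    "'a measure \<Rightarrow> (nat \<Rightarrow> 'a \<Rightarrow> complex) \<Rightarrow> ('a \<Rightarrow> complex) \<Rightarrow> bool" where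
  "Ltwo_tendsto M F f \<longleftrightarrow>
     (\<forall>n. F n \<in> Ltwo M) \<and> f \<in> Ltwo M \<and> (\<lambda>n. norm2 M (\<lambda>x. F n x - f x)) \<longlonglongrightarrow> 0"

definition frame :: "'a measure \<Rightarrow> 'i set \<Rightarrow> ('i \<Rightarrow> 'a \<Rightarrow> complex) \<Rightarrow> bool" where
  "frame M I e \<longleftrightarrow>
     (\<forall>i\<in>I. e i \<in> Ltwo M) \<and>
     (\<exists>A>0. \<exists>B>0. \<forall>f\<in>Ltwo M.
        (\<lambda>i. (cmod (inner2 M f (e i)))\<^sup>2) summable_on I \<and>
        A * (norm2 M f)\<^sup>2 \<le> (\<Sum>\<^sub>\<infinity>i\<in>I. (cmod (inner2 M f (e i)))\<^sup>2) \<and>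
        (\<Sum>\<^sub>\<infinity>i\<in>I. (cmod (inner2 M f (e i)))\<^sup>2) \<le> B * (norm2 M f)\<^sup>2)"

definition riesz_basis :: "'a measure \<Rightarrow> 'i set \<Rightarrow> ('i \<Rightarrow> 'a \<Rightarrow> complex) \<Rightarrow> bool" where
  "riesz_basis M I e \<longleftrightarrow> frame M I e \<and> (\<forall>j\<in>I. \<not> frame M (I - {j}) e)"


section \<open>Hilbert-Schmidt operators and their spreading functions\<close>

text \<open>
  Operators act on functions rather than on almost-everywhere classes, so all operator identities
  are required only almost everywhere, and only on square-integrable arguments. The kernel and the
  spreading function of an operator are unique up to null sets; \<open>hs_kernel\<close> and \<open>spreading\<close> choose a
  representative.
\<close>

type_synonym fun_op = "(real \<Rightarrow> complex) \<Rightarrow> real \<Rightarrow> complex"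

definition has_hs_kernel :: "fun_op \<Rightarrow> (real \<times> real \<Rightarrow> complex) \<Rightarrow> bool" where
  "has_hs_kernel H \<kappa> \<longleftrightarrow>
     \<kappa> \<in> Ltwo lborel \<and>
     (\<forall>f\<in>Ltwo lborel. AE x in lborel. H f x = (\<integral>t. \<kappa> (x, t) * f t \<partial>lborel))"

definition HS :: "fun_op set" where
  "HS = {H. \<exists>\<kappa>. has_hs_kernel H \<kappa>}"

definition hs_kernel :: "fun_op \<Rightarrow> real \<times> real \<Rightarrow> complex" where
  "hs_kernel H = (SOME \<kappa>. has_hs_kernel H \<kappa>)"

definition hs_norm :: "fun_op \<Rightarrow> real" where
  "hs_norm H = norm2 lborel (hs_kernel H)"

definition impulse_response :: "fun_op \<Rightarrow> real \<Rightarrow> real \<Rightarrow> complex" where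
  "impulse_response H t x = hs_kernel H (x, x - t)"

text \<open>
  The Fourier transform in the second variable is the limit of the truncated
  Fourier integrals in the square-integrable functions on the plane.
\<close>

definition has_spreading :: "fun_op \<Rightarrow> (real \<times> real \<Rightarrow> complex) \<Rightarrow> bool" where
  "has_spreading H \<eta> \<longleftrightarrow>
     Ltwo_tendsto lborel
       (\<lambda>n (t, \<nu>). \<integral>x\<in>{- real n..real n}. impulse_response H t x * cis (- 2 * pi * x * \<nu>) \<partial>lborel) \<eta>"

definition spreading :: "fun_op \<Rightarrow> real \<times> real \<Rightarrow> complex" where
  "spreading H = (SOME \<eta>. has_spreading H \<eta>)"

definition ess_support :: "(real \<times> real \<Rightarrow> complex) \<Rightarrow> (real \<times> real) set" where
  "ess_support f =
     {z. \<forall>U. open U \<and> z \<in> U \<longrightarrow> \<not> (AE w in lborel. w \<in> U \<longrightarrow> f w = 0)}"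

definition OPW :: "(real \<times> real) set \<Rightarrow> fun_op set" where
  "OPW S = {H \<in> HS. ess_support (spreading H) \<subseteq> S}"


section \<open>The Feichtinger algebra and its dual\<close>

definition gabor :: "(real \<Rightarrow> complex) \<Rightarrow> real \<times> real \<Rightarrow> complex" where
  "gabor f = (\<lambda>(t, \<nu>).
     \<integral>x. f x * cnj (cis (2 * pi * \<nu> * x) * complex_of_real (exp (- pi * (x - t)\<^sup>2))) \<partial>lborel)"

text \<open>
  Every class in the Feichtinger algebra has exactly one continuous representative. The set
  \<open>S0\<close> consists of these, so that point evaluations make sense on it.
\<close>

definition S0 :: "(real \<Rightarrow> complex) set" where
  "S0 = {f \<in> Ltwo lborel. continuous_on UNIV f \<and> integrable lborel (gabor f)}"

definition S0_norm :: "(real \<Rightarrow> complex) \<Rightarrow> real" where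
  "S0_norm f = (\<integral>z. cmod (gabor f z) \<partial>lborel)"

definition S0_dual :: "((real \<Rightarrow> complex) \<Rightarrow> complex) set" where
  "S0_dual = {\<phi>.
     (\<forall>f\<in>S0. \<forall>g\<in>S0. \<forall>a b. \<phi> (\<lambda>x. a * f x + b * g x) = a * \<phi> f + b * \<phi> g) \<and>
     (\<exists>B. \<forall>f\<in>S0. cmod (\<phi> f) \<le> B * S0_norm f)}"

definition delta_train :: "(int \<Rightarrow> complex) \<Rightarrow> (int \<Rightarrow> real) \<Rightarrow> (real \<Rightarrow> complex) \<Rightarrow> complex" where
  "delta_train c \<Lambda> f = (\<Sum>\<^sub>\<infinity>k. c k * f (\<Lambda> k))"

definition delta_train_in_S0_dual :: "(int \<Rightarrow> complex) \<Rightarrow> (int \<Rightarrow> real) \<Rightarrow> bool" where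
  "delta_train_in_S0_dual c \<Lambda> \<longleftrightarrow>
     (\<forall>f\<in>S0. (\<lambda>k. c k * f (\<Lambda> k)) summable_on UNIV) \<and> delta_train c \<Lambda> \<in> S0_dual"


section \<open>Identification and sets of sampling\<close>

text \<open>
  For compact \<open>S\<close> and \<open>H \<in> OPW S\<close>, the function \<open>impulse_response_cont H t\<close> is, for almost
  every \<open>t\<close>, the continuous representative of \<open>impulse_response H t\<close>.
\<close>

definition impulse_response_cont :: "fun_op \<Rightarrow> real \<Rightarrow> real \<Rightarrow> complex" where
  "impulse_response_cont H t x = (\<integral>\<nu>. spreading H (t, \<nu>) * cis (2 * pi * x * \<nu>) \<partial>lborel)"

text \<open>The value of (the extension of) \<open>H\<close> on the delta train with weights \<open>c\<close> and nodes \<open>\<Lambda>\<close>.\<close>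

definition response :: "fun_op \<Rightarrow> (int \<Rightarrow> complex) \<Rightarrow> (int \<Rightarrow> real) \<Rightarrow> real \<Rightarrow> complex" where
  "response H c \<Lambda> x = (\<Sum>\<^sub>\<infinity>k. c k * impulse_response_cont H (x - \<Lambda> k) x)"

text \<open>
  An input identifies an operator class through the map sending each operator \<open>H\<close> of the class
  to its output on that input; \<open>R\<close> is this map.
\<close>

definition identifies :: "(fun_op \<Rightarrow> real \<Rightarrow> complex) \<Rightarrow> fun_op set \<Rightarrow> bool" where
  "identifies R \<H> \<longleftrightarrow>
     (\<exists>a>0. \<exists>b>0. \<forall>H\<in>\<H>. R H \<in> Ltwo lborel \<and>
        a * hs_norm H \<le> norm2 lborel (R H) \<and> norm2 lborel (R H) \<le> b * hs_norm H)"

definition set_of_sampling :: "(int \<Rightarrow> real) \<Rightarrow> fun_op set \<Rightarrow> bool" where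
  "set_of_sampling \<Lambda> \<H> \<longleftrightarrow>
     (\<exists>c. bounded (range c) \<and> delta_train_in_S0_dual c \<Lambda> \<and>
          identifies (\<lambda>H. response H c \<Lambda>) \<H>)"

end

(*
  Let H have spreading function \<eta> and let h(t,.) be its impulse response. The values
  a_k(t) = h(t, t + \<Lambda> k) are the coefficients of cis(2 pi t .) \<eta>(t,.) against the Riesz basis, so they
  can be prescribed independently of each other, while the response is the sum over k of
  c_k a_k(x - \<Lambda> k). If \<Lambda> (i+1) - \<Lambda> i < T, the supports of a_i(x - \<Lambda> i) and a_(i+1)(x - \<Lambda> (i+1)) in x
  overlap in an interval, where the two terms can be made to cancel. The resulting nonzero
  operator has zero response, so it violates the lower identification bound.

  The dual vector of an exact frame at index j is the limit of vectors f_n with <f_n, e_j> = 1 whose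
  other coefficients tend to 0 in the square-summable sense: these exist because the frame without
  e_j has no lower bound, and they are a Cauchy sequence because the full frame has one.
*)
theory Submission
  imports Defs "HOL-Probability.Characteristic_Functions"
begin

section \<open>Square-integrable functions\<close>

text \<open>The kernel and the spreading function of an operator are picked by choice, so an
  operator built from a prescribed \<open>\<eta>\<close> is of use only once the chosen data are
  known to agree with \<open>\<eta>\<close> almost everywhere. For the kernel this is uniqueness up
  to null sets, tested on indicator functions. For the spreading function, the truncated Fourier
  integrals of the chosen impulse response must tend to \<open>\<eta>\<close> in mean square; this
  is Fourier inversion on almost every slice and rests on the Plancherel theorem, proved by damping
  with Gaussians.

  The frequency support of \<open>\<eta>\<close> is bounded, so almost every slice is integrable and
  its inverse transform is a genuine integral with values at single points.

  The weights of the delta train are arbitrary and may vanish at the two critical nodes, so the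
  cancelling pair of amplitudes is read off from them. A product of a time profile with a dual
  vector, suitably modulated, gives a slice with only one nonzero sample; the sum of two such
  products suffices.\<close>

lemma borel_measurable_cnj [measurable (raw)]:
  "f \<in> borel_measurable M \<Longrightarrow> (\<lambda>x. cnj (f x)) \<in> borel_measurable M"
  by (rule measurable_compose[of f M borel cnj borel])
     (auto intro!: borel_measurable_continuous_onI continuous_intros)

lemma Ltwo_measurable [measurable_dest]: "f \<in> Ltwo M \<Longrightarrow> f \<in> borel_measurable M"
  by (simp add: Ltwo_def)

lemma Ltwo_integrable: "f \<in> Ltwo M \<Longrightarrow> integrable M (\<lambda>x. (cmod (f x))\<^sup>2)"
  by (simp add: Ltwo_def)

lemma norm2_nonneg [simp]: "0 \<le> norm2 M f"
  by (simp add: norm2_def)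

lemma norm2_squared: "(norm2 M f)\<^sup>2 = (\<integral>x. (cmod (f x))\<^sup>2 \<partial>M)"
  by (simp add: norm2_def)

lemma Ltwo_iff_nn_integral:
  assumes "f \<in> borel_measurable M"
  shows "f \<in> Ltwo M \<longleftrightarrow> (\<integral>\<^sup>+x. ennreal ((cmod (f x))\<^sup>2) \<partial>M) < \<infinity>"
  using assms by (simp add: Ltwo_def integrable_iff_bounded)

lemma nn_integral_norm2:
  assumes "f \<in> Ltwo M"
  shows "(\<integral>\<^sup>+x. ennreal ((cmod (f x))\<^sup>2) \<partial>M) = ennreal ((norm2 M f)\<^sup>2)"
  unfolding norm2_squared using Ltwo_integrable[OF assms] by (intro nn_integral_eq_integral) auto

lemma nn_integral_le_imp_Ltwo:
  assumes "f \<in> borel_measurable M" "(\<integral>\<^sup>+x. ennreal ((cmod (f x))\<^sup>2) \<partial>M) \<le> ennreal (C\<^sup>2)" "0 \<le> C"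
  shows "f \<in> Ltwo M" "norm2 M f \<le> C"
proof -
  show f: "f \<in> Ltwo M"
    using assms by (auto simp: Ltwo_iff_nn_integral intro: le_less_trans)
  have "(norm2 M f)\<^sup>2 \<le> C\<^sup>2"
    using assms(2) nn_integral_norm2[OF f] by simp
  then show "norm2 M f \<le> C" using assms(3) by (rule power2_le_imp_le)
qed

lemma Ltwo_AE_bound:
  assumes "g \<in> Ltwo M" "f \<in> borel_measurable M" "AE x in M. cmod (f x) \<le> cmod (g x)"
  shows "f \<in> Ltwo M" "norm2 M f \<le> norm2 M g"
proof -
  have "(\<integral>\<^sup>+x. ennreal ((cmod (f x))\<^sup>2) \<partial>M) \<le> (\<integral>\<^sup>+x. ennreal ((cmod (g x))\<^sup>2) \<partial>M)"
    using assms(3) by (intro nn_integral_mono_AE) (auto intro!: ennreal_leI power_mono)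
  then have "(\<integral>\<^sup>+x. ennreal ((cmod (f x))\<^sup>2) \<partial>M) \<le> ennreal ((norm2 M g)\<^sup>2)"
    by (simp add: nn_integral_norm2 assms)
  from nn_integral_le_imp_Ltwo[OF assms(2) this] show "f \<in> Ltwo M" "norm2 M f \<le> norm2 M g" by auto
qed

lemma norm2_cong_AE:
  assumes "f \<in> borel_measurable M" "g \<in> borel_measurable M" "AE x in M. f x = g x"
  shows "norm2 M f = norm2 M g"
proof -
  note [measurable] = assms(1,2)
  show ?thesis
    unfolding norm2_def using assms(3) by (intro arg_cong[where f=sqrt] integral_cong_AE) auto
qed

lemma Ltwo_cmult:
  assumes "f \<in> Ltwo M" shows "(\<lambda>x. a * f x) \<in> Ltwo M"
  using assms by (auto simp: Ltwo_def norm_mult power_mult_distrib)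

lemma Ltwo_add:
  assumes f: "f \<in> Ltwo M" and g: "g \<in> Ltwo M" shows "(\<lambda>x. f x + g x) \<in> Ltwo M"
proof -
  have [measurable]: "f \<in> borel_measurable M" "g \<in> borel_measurable M" using f g by measurable
  have le: "(cmod (f x + g x))\<^sup>2 \<le> 2 * (cmod (f x))\<^sup>2 + 2 * (cmod (g x))\<^sup>2" for x
  proof -
    have "(cmod (f x + g x))\<^sup>2 \<le> (cmod (f x) + cmod (g x))\<^sup>2"
      by (intro power_mono norm_triangle_ineq) auto
    also have "\<dots> \<le> 2 * (cmod (f x))\<^sup>2 + 2 * (cmod (g x))\<^sup>2"
      using sum_squares_bound[of "cmod (f x)" "cmod (g x)"] by (simp add: power2_sum)
    finally show ?thesis .
  qed
  have "integrable M (\<lambda>x. 2 * (cmod (f x))\<^sup>2 + 2 * (cmod (g x))\<^sup>2)"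
    using Ltwo_integrable[OF f] Ltwo_integrable[OF g] by auto
  then have "integrable M (\<lambda>x. (cmod (f x + g x))\<^sup>2)"
    by (rule Bochner_Integration.integrable_bound) (auto intro!: AE_I2 order_trans[OF le])
  then show ?thesis by (simp add: Ltwo_def)
qed

lemma Ltwo_diff:
  assumes "f \<in> Ltwo M" "g \<in> Ltwo M" shows "(\<lambda>x. f x - g x) \<in> Ltwo M"
  using Ltwo_add[OF assms(1) Ltwo_cmult[OF assms(2), of "-1"]] by simp

text \<open>Cauchy-Schwarz for the moduli. Integrability comes first, from a pointwise bound by the
  sum of squares, so that the inequality for nonnegative integrals can be read as one between real
  numbers.\<close>

lemma Ltwo_norm_mult:
  assumes f: "f \<in> Ltwo M" and g: "g \<in> Ltwo M"
  shows "integrable M (\<lambda>x. cmod (f x) * cmod (g x))"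
    and "(\<integral>x. cmod (f x) * cmod (g x) \<partial>M) \<le> norm2 M f * norm2 M g"
proof -
  have [measurable]: "f \<in> borel_measurable M" "g \<in> borel_measurable M" using f g by measurable
  have le: "(cmod (f x) * cmod (g x)) \<le> (cmod (f x))\<^sup>2 + (cmod (g x))\<^sup>2" for x
    using sum_squares_bound[of "cmod (f x)" "cmod (g x)"]
      mult_nonneg_nonneg[OF norm_ge_zero[of "f x"] norm_ge_zero[of "g x"]] by linarith
  have "integrable M (\<lambda>x. (cmod (f x))\<^sup>2 + (cmod (g x))\<^sup>2)"
    using Ltwo_integrable[OF f] Ltwo_integrable[OF g] by auto
  then show int: "integrable M (\<lambda>x. cmod (f x) * cmod (g x))"
    by (rule Bochner_Integration.integrable_bound) (auto intro!: AE_I2 order_trans[OF le])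
  have "(\<integral>\<^sup>+x. ennreal (cmod (f x)) * ennreal (cmod (g x)) \<partial>M)\<^sup>2 \<le> 
      (\<integral>\<^sup>+x. (ennreal (cmod (f x)))\<^sup>2 \<partial>M) * (\<integral>\<^sup>+x. (ennreal (cmod (g x)))\<^sup>2 \<partial>M)"
    by (rule Cauchy_Schwarz_nn_integral) auto
  also have "(\<integral>\<^sup>+x. ennreal (cmod (f x)) * ennreal (cmod (g x)) \<partial>M) = ennreal (\<integral>x. cmod (f x) * cmod (g x) \<partial>M)"
    using int by (subst nn_integral_eq_integral[symmetric]) (auto simp: ennreal_mult)
  finally have "ennreal ((\<integral>x. cmod (f x) * cmod (g x) \<partial>M)\<^sup>2) \<le> ennreal ((norm2 M f * norm2 M g)\<^sup>2)"
    using f g by (simp add: ennreal_power nn_integral_norm2 ennreal_mult[symmetric] power_mult_distrib)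
  then have "(\<integral>x. cmod (f x) * cmod (g x) \<partial>M)\<^sup>2 \<le> (norm2 M f * norm2 M g)\<^sup>2"
    by simp
  then show "(\<integral>x. cmod (f x) * cmod (g x) \<partial>M) \<le> norm2 M f * norm2 M g"
    by (rule power2_le_imp_le) simp
qed

lemma Ltwo_mult_cnj_integrable:
  assumes f: "f \<in> Ltwo M" and g: "g \<in> Ltwo M"
  shows "integrable M (\<lambda>x. f x * cnj (g x))"
proof -
  have [measurable]: "f \<in> borel_measurable M" "g \<in> borel_measurable M" using f g by measurable
  show ?thesis
    by (rule Bochner_Integration.integrable_bound[OF Ltwo_norm_mult(1)[OF f g]]) (auto simp: norm_mult)
qed

lemma cmod_inner2_le:
  assumes "f \<in> Ltwo M" "g \<in> Ltwo M"
  shows "cmod (inner2 M f g) \<le> norm2 M f * norm2 M g"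
proof -
  have "cmod (inner2 M f g) \<le> (\<integral>x. cmod (f x * cnj (g x)) \<partial>M)"
    unfolding inner2_def by (rule integral_norm_bound)
  then show ?thesis using Ltwo_norm_mult(2)[OF assms] by (simp add: norm_mult)
qed

lemma inner2_diff_left:
  assumes "f \<in> Ltwo M" "h \<in> Ltwo M" "g \<in> Ltwo M"
  shows "inner2 M (\<lambda>x. f x - h x) g = inner2 M f g - inner2 M h g"
  unfolding inner2_def using assms
  by (subst Bochner_Integration.integral_diff[symmetric]) (auto simp: algebra_simps Ltwo_mult_cnj_integrable)

lemma inner2_cmult_left: "inner2 M (\<lambda>x. a * f x) g = a * inner2 M f g"
  unfolding inner2_def by (simp add: mult.assoc)

lemma norm2_triangle:
  assumes f: "f \<in> Ltwo M" and g: "g \<in> Ltwo M"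
  shows "norm2 M (\<lambda>x. f x + g x) \<le> norm2 M f + norm2 M g"
proof (rule power2_le_imp_le)
  have "(norm2 M (\<lambda>x. f x + g x))\<^sup>2 = (\<integral>x. (cmod (f x + g x))\<^sup>2 \<partial>M)" by (rule norm2_squared)
  also have "\<dots> \<le> (\<integral>x. (cmod (f x))\<^sup>2 + (cmod (g x))\<^sup>2 + 2 * (cmod (f x) * cmod (g x)) \<partial>M)"
  proof (rule integral_mono)
    show "integrable M (\<lambda>x. (cmod (f x + g x))\<^sup>2)" using Ltwo_integrable[OF Ltwo_add[OF f g]] .
    show "integrable M (\<lambda>x. (cmod (f x))\<^sup>2 + (cmod (g x))\<^sup>2 + 2 * (cmod (f x) * cmod (g x)))"
      using Ltwo_integrable[OF f] Ltwo_integrable[OF g] Ltwo_norm_mult(1)[OF f g] by auto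
    show "(cmod (f x + g x))\<^sup>2 \<le> (cmod (f x))\<^sup>2 + (cmod (g x))\<^sup>2 + 2 * (cmod (f x) * cmod (g x))" for x
      using power_mono[OF norm_triangle_ineq[of "f x" "g x"], of 2] by (simp add: power2_sum mult.assoc)
  qed
  also have "\<dots> = (norm2 M f)\<^sup>2 + (norm2 M g)\<^sup>2 + 2 * (\<integral>x. cmod (f x) * cmod (g x) \<partial>M)"
    using Ltwo_integrable[OF f] Ltwo_integrable[OF g] Ltwo_norm_mult(1)[OF f g] by (simp add: norm2_squared)
  also have "\<dots> \<le> (norm2 M f + norm2 M g)\<^sup>2"
    using Ltwo_norm_mult(2)[OF f g] by (simp add: power2_sum)
  finally show "(norm2 M (\<lambda>x. f x + g x))\<^sup>2 \<le> (norm2 M f + norm2 M g)\<^sup>2" .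
qed simp

lemma norm2_minus_commute: "norm2 M (\<lambda>x. f x - g x) = norm2 M (\<lambda>x. g x - f x)"
  by (simp add: norm2_def norm_minus_commute)

lemma norm2_diff_triangle:
  assumes "f \<in> Ltwo M" "g \<in> Ltwo M" "h \<in> Ltwo M"
  shows "norm2 M (\<lambda>x. f x - h x) \<le> norm2 M (\<lambda>x. f x - g x) + norm2 M (\<lambda>x. g x - h x)"
  using norm2_triangle[OF Ltwo_diff[OF assms(1,2)] Ltwo_diff[OF assms(2,3)]] by simp

lemma norm2_eq_0_iff:
  assumes f: "f \<in> Ltwo M"
  shows "norm2 M f = 0 \<longleftrightarrow> (AE x in M. f x = 0)"
  using integral_nonneg_eq_0_iff_AE[OF Ltwo_integrable[OF f]] by (simp add: norm2_def)

section \<open>Mean-square limits and completeness\<close>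

lemma Ltwo_limit_unique:
  assumes "Ltwo_tendsto M F f" "Ltwo_tendsto M F g"
  shows "AE x in M. f x = g x"
proof -
  have F: "F n \<in> Ltwo M" and f: "f \<in> Ltwo M" and g: "g \<in> Ltwo M" for n
    using assms by (auto simp: Ltwo_tendsto_def)
  have "norm2 M (\<lambda>x. f x - g x) \<le> norm2 M (\<lambda>x. F n x - f x) + norm2 M (\<lambda>x. F n x - g x)" for n
    using norm2_diff_triangle[OF f F[of n] g] by (simp add: norm2_minus_commute[of M f])
  moreover have "(\<lambda>n. norm2 M (\<lambda>x. F n x - f x) + norm2 M (\<lambda>x. F n x - g x)) \<longlonglongrightarrow> 0 + 0"
    using assms unfolding Ltwo_tendsto_def by (intro tendsto_add) auto
  ultimately have "norm2 M (\<lambda>x. f x - g x) \<le> 0 + 0"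
    by (intro LIMSEQ_le_const) auto
  then have "AE x in M. f x - g x = 0"
    using norm2_eq_0_iff[OF Ltwo_diff[OF f g]] norm2_nonneg[of M "\<lambda>x. f x - g x"] by auto
  then show ?thesis by simp
qed

lemma tendsto_inner2:
  assumes lim: "Ltwo_tendsto M F f" and g: "g \<in> Ltwo M"
  shows "(\<lambda>n. inner2 M (F n) g) \<longlonglongrightarrow> inner2 M f g"
proof -
  have F: "F n \<in> Ltwo M" and f: "f \<in> Ltwo M" for n
    using lim by (auto simp: Ltwo_tendsto_def)
  have "(\<lambda>n. norm2 M (\<lambda>x. F n x - f x) * norm2 M g) \<longlonglongrightarrow> 0"
    using lim by (auto simp: Ltwo_tendsto_def intro!: tendsto_mult_left_zero)
  then have "(\<lambda>n. inner2 M (F n) g - inner2 M f g) \<longlonglongrightarrow> 0"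
  proof (rule Lim_null_comparison[rotated], intro always_eventually allI)
    show "cmod (inner2 M (F n) g - inner2 M f g) \<le> norm2 M (\<lambda>x. F n x - f x) * norm2 M g" for n
      using cmod_inner2_le[OF Ltwo_diff[OF F[of n] f] g] by (simp add: inner2_diff_left[OF F f g])
  qed
  then show ?thesis by (rule LIM_zero_cancel)
qed

text \<open>The squared increments integrate to at most \<open>(1/4)^n\<close>, so even after
  weighting by \<open>2^n\<close> their sum is integrable and hence finite almost everywhere. At
  such a point the increments are bounded by a constant times \<open>(sqrt (1/2))^n\<close>, and the
  sequence telescopes.\<close>

lemma Ltwo_rapid_AE_convergent:
  assumes F: "\<And>n. F n \<in> Ltwo M" and rapid: "\<And>n. norm2 M (\<lambda>x. F (Suc n) x - F n x) \<le> (1/2)^n"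
  shows "AE x in M. convergent (\<lambda>n. F n x)"
proof -
  have [measurable]: "F n \<in> borel_measurable M" for n using F by measurable
  define d where "d n x = (cmod (F (Suc n) x - F n x))\<^sup>2" for n x
  have [measurable]: "d n \<in> borel_measurable M" for n unfolding d_def by measurable
  have "(\<integral>\<^sup>+x. (\<Sum>n. ennreal (2^n * d n x)) \<partial>M) = (\<Sum>n. \<integral>\<^sup>+x. ennreal (2^n * d n x) \<partial>M)"
    by (rule nn_integral_suminf) auto
  also have "\<dots> \<le> (\<Sum>n. ennreal ((1/2)^n))"
  proof (rule suminf_le)
    fix n
    have "(\<integral>\<^sup>+x. ennreal (2^n * d n x) \<partial>M) = ennreal (2^n) * (\<integral>\<^sup>+x. ennreal (d n x) \<partial>M)"
      by (subst nn_integral_cmult[symmetric]) (auto simp: d_def ennreal_mult)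
    also have "\<dots> = ennreal (2^n * (norm2 M (\<lambda>x. F (Suc n) x - F n x))\<^sup>2)"
      using nn_integral_norm2[OF Ltwo_diff[OF F[of "Suc n"] F[of n]]] by (simp add: d_def ennreal_mult)
    also have "\<dots> \<le> ennreal (2^n * ((1/2)^n)\<^sup>2)"
      using rapid[of n] by (intro ennreal_leI mult_left_mono power_mono) auto
    also have "2^n * ((1/2)^n)\<^sup>2 = ((1/2)^n :: real)"
      by (simp add: power2_eq_square power_divide)
    finally show "(\<integral>\<^sup>+x. ennreal (2^n * d n x) \<partial>M) \<le> ennreal ((1/2)^n)" .
  qed auto
  also have "\<dots> = ennreal (\<Sum>n. (1/2)^n)"
    by (intro suminf_ennreal2 summable_geometric) auto
  also have "\<dots> < \<infinity>" by simp
  finally have "AE x in M. (\<Sum>n. ennreal (2^n * d n x)) \<noteq> \<infinity>"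
    by (intro nn_integral_PInf_AE) auto
  then show ?thesis
  proof (rule AE_mp, intro AE_I2 impI)
    fix x assume "(\<Sum>n. ennreal (2^n * d n x)) \<noteq> \<infinity>"
    then obtain C where C: "(\<Sum>n. ennreal (2^n * d n x)) = ennreal C" "C \<ge> 0" 
      by (cases "\<Sum>n. ennreal (2^n * d n x)") auto
    have le: "cmod (F (Suc n) x - F n x) \<le> sqrt C * (sqrt (1/2))^n" for n
    proof -
      have "ennreal (2^n * d n x) \<le> (\<Sum>n. ennreal (2^n * d n x))"
        using sum_le_suminf[of "\<lambda>n. ennreal (2^n * d n x)" "{n}"] by auto
      then have "2^n * d n x \<le> C" using C by simp
      then have "(cmod (F (Suc n) x - F n x))\<^sup>2 \<le> C * (1/2)^n" 
        by (simp add: d_def field_simps)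
      then have "cmod (F (Suc n) x - F n x) \<le> sqrt (C * (1/2)^n)"
        by (rule real_le_rsqrt)
      then show ?thesis by (simp add: real_sqrt_mult real_sqrt_power)
    qed
    have "summable (\<lambda>n. sqrt C * (sqrt (1/2))^n)"
      by (intro summable_mult summable_geometric) (simp add: real_sqrt_divide)
    then have "summable (\<lambda>n. F (Suc n) x - F n x)"
      by (rule summable_comparison_test'[where N=0]) (use le in auto)
    then have "convergent (\<lambda>n. (\<Sum>i<n. F (Suc i) x - F i x) + F 0 x)"
      by (intro convergent_add convergent_const) (simp add: summable_iff_convergent)
    moreover have "(\<Sum>i<n. F (Suc i) x - F i x) + F 0 x = F n x" for n
      using sum_lessThan_telescope[of "\<lambda>i. F i x" n] by simp
    ultimately show "convergent (\<lambda>n. F n x)" by simp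
  qed
qed

text \<open>Riesz-Fischer: a rapidly converging subsequence supplies a pointwise limit, and Fatou's
  lemma turns the Cauchy condition into convergence of the whole sequence.\<close>

lemma Ltwo_complete:
  assumes F: "\<And>n. F n \<in> Ltwo M"
    and Cauchy: "\<And>e. e > 0 \<Longrightarrow> \<exists>N. \<forall>m\<ge>N. \<forall>n\<ge>N. norm2 M (\<lambda>x. F m x - F n x) < e"
  shows "\<exists>f. Ltwo_tendsto M F f"
proof -
  have [measurable]: "F n \<in> borel_measurable M" for n using F by measurable
  have "\<forall>k. \<exists>N. \<forall>m\<ge>N. \<forall>n\<ge>N. norm2 M (\<lambda>x. F m x - F n x) < (1/2)^k"
    using Cauchy by simp
  then obtain N where N: "\<And>k m n. m \<ge> N k \<Longrightarrow> n \<ge> N k \<Longrightarrow> norm2 M (\<lambda>x. F m x - F n x) < (1/2)^k"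
    by metis
  \<comment> \<open>Summing the \<open>N i\<close> puts both \<open>r k\<close> and
    \<open>r (Suc k)\<close> beyond \<open>N k\<close>; the summand \<open>k\<close> makes the
    indices unbounded, so that the subsequence eventually passes any threshold.\<close>
  define r where "r k = (\<Sum>i\<le>k. N i) + k" for k
  have rN: "r k \<ge> N k" "r (Suc k) \<ge> N k" "r k \<ge> k" for k
    using member_le_sum[of k "{..k}" N] by (auto simp: r_def)
  have conv: "AE x in M. convergent (\<lambda>k. F (r k) x)"
    by (rule Ltwo_rapid_AE_convergent) (use F N[OF rN(2) rN(1)] in \<open>auto intro: less_imp_le\<close>)
  define f where "f x = lim (\<lambda>k. F (r k) x)" for x
  have [measurable]: "f \<in> borel_measurable M"
    unfolding f_def by measurable
  \<comment> \<open>Fatou along the subsequence. Used once with a fixed index to place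
    \<open>f\<close> in \<open>Ltwo M\<close>, and again for every tail to obtain
    convergence.\<close>
  have bound: "(\<lambda>x. F n x - f x) \<in> Ltwo M \<and> norm2 M (\<lambda>x. F n x - f x) \<le> e" 
    if e: "e > 0" and m: "\<And>m. m \<ge> K \<Longrightarrow> norm2 M (\<lambda>x. F n x - F m x) < e" for n e K
  proof -
    have "(\<integral>\<^sup>+x. ennreal ((cmod (F n x - f x))\<^sup>2) \<partial>M) \<le> 
          (\<integral>\<^sup>+x. liminf (\<lambda>k. ennreal ((cmod (F n x - F (r k) x))\<^sup>2)) \<partial>M)"
    proof (rule nn_integral_mono_AE, use conv in \<open>rule AE_mp\<close>, intro AE_I2 impI)
      fix x assume "convergent (\<lambda>k. F (r k) x)"
      then have "(\<lambda>k. F (r k) x) \<longlonglongrightarrow> f x" by (simp add: f_def convergent_LIMSEQ_iff)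
      then have "(\<lambda>k. ennreal ((cmod (F n x - F (r k) x))\<^sup>2)) \<longlonglongrightarrow> ennreal ((cmod (F n x - f x))\<^sup>2)"
        by (intro tendsto_intros tendsto_ennrealI)
      from lim_imp_Liminf[OF trivial_limit_sequentially this]
      show "ennreal ((cmod (F n x - f x))\<^sup>2) \<le> liminf (\<lambda>k. ennreal ((cmod (F n x - F (r k) x))\<^sup>2))"
        by (rule eq_refl[OF sym])
    qed
    also have "\<dots> \<le> liminf (\<lambda>k. \<integral>\<^sup>+x. ennreal ((cmod (F n x - F (r k) x))\<^sup>2) \<partial>M)"
      by (rule nn_integral_liminf) auto
    also have "\<dots> \<le> liminf (\<lambda>k. ennreal (e\<^sup>2))"
    proof (rule Liminf_mono, rule eventually_sequentiallyI[of K])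
      fix k assume "k \<ge> K"
      then have "r k \<ge> K" using rN(3)[of k] by linarith
      from m[OF this] show "(\<integral>\<^sup>+x. ennreal ((cmod (F n x - F (r k) x))\<^sup>2) \<partial>M) \<le> ennreal (e\<^sup>2)"
        using nn_integral_norm2[OF Ltwo_diff[OF F[of n] F[of "r k"]]] by (simp add: power_mono ennreal_leI)
    qed
    also have "\<dots> = ennreal (e\<^sup>2)" by (simp add: Liminf_const)
    finally show ?thesis using nn_integral_le_imp_Ltwo[of "\<lambda>x. F n x - f x" M e] e by auto
  qed
  obtain K where "\<forall>m\<ge>K. \<forall>n\<ge>K. norm2 M (\<lambda>x. F m x - F n x) < 1" using Cauchy[of 1] by auto
  then have "(\<lambda>x. F K x - f x) \<in> Ltwo M" using bound[of 1 K K] by auto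
  from Ltwo_diff[OF F[of K] this] have f: "f \<in> Ltwo M" by simp
  have "(\<lambda>n. norm2 M (\<lambda>x. F n x - f x)) \<longlonglongrightarrow> 0"
  proof (rule LIMSEQ_I)
    fix e :: real assume "e > 0"
    then obtain K where K: "\<forall>m\<ge>K. \<forall>n\<ge>K. norm2 M (\<lambda>x. F m x - F n x) < e/2" 
      using Cauchy[of "e/2"] by auto
    have "norm2 M (\<lambda>x. F n x - f x) \<le> e/2" if "n \<ge> K" for n
      using bound[of "e/2" K n] \<open>e > 0\<close> K that by auto
    then show "\<exists>K. \<forall>n\<ge>K. norm (norm2 M (\<lambda>x. F n x - f x) - 0) < e"
      using \<open>e > 0\<close> by (intro exI[of _ K]) (auto intro: le_less_trans[of _ "e/2"])
  qed
  then show ?thesis using F f by (auto simp: Ltwo_tendsto_def)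
qed

section \<open>Biorthogonal systems of Riesz bases\<close>

text \<open>Dropping one vector keeps summability and the upper bound, so only the lower bound can
  be lost; the full lower bound survives if the missing coefficient is added back.\<close>

lemma frame_remove_Bessel:
  assumes "\<forall>f\<in>Ltwo M. (\<lambda>i. (cmod (inner2 M f (e i)))\<^sup>2) summable_on I \<and>
        A * (norm2 M f)\<^sup>2 \<le> (\<Sum>\<^sub>\<infinity>i\<in>I. (cmod (inner2 M f (e i)))\<^sup>2) \<and>
        (\<Sum>\<^sub>\<infinity>i\<in>I. (cmod (inner2 M f (e i)))\<^sup>2) \<le> B * (norm2 M f)\<^sup>2"
    and "j \<in> I" and f: "f \<in> Ltwo M"
  defines "S \<equiv> \<lambda>f. \<Sum>\<^sub>\<infinity>i\<in>I - {j}. (cmod (inner2 M f (e i)))\<^sup>2"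
  shows "(\<lambda>i. (cmod (inner2 M f (e i)))\<^sup>2) summable_on (I - {j})"
    and "A * (norm2 M f)\<^sup>2 \<le> S f + (cmod (inner2 M f (e j)))\<^sup>2"
    and "S f \<le> B * (norm2 M f)\<^sup>2"
    and "0 \<le> S f"
proof -
  let ?a = "\<lambda>i. (cmod (inner2 M f (e i)))\<^sup>2"
  have sum: "?a summable_on I" using assms by blast
  then show sum': "?a summable_on (I - {j})"
    by (rule summable_on_subset_banach) auto
  have "infsum ?a (insert j (I - {j})) = ?a j + S f"
    unfolding S_def by (rule infsum_insert[OF sum']) auto
  then have eq: "infsum ?a I = ?a j + S f" using \<open>j \<in> I\<close> by (simp add: insert_absorb)
  show "A * (norm2 M f)\<^sup>2 \<le> S f + ?a j" using assms(1) f eq by (auto simp: add.commute)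
  show "0 \<le> S f" unfolding S_def by (rule infsum_nonneg) auto
  have "infsum ?a I \<le> B * (norm2 M f)\<^sup>2" using assms(1) f by blast
  moreover have "0 \<le> ?a j" by simp
  ultimately show "S f \<le> B * (norm2 M f)\<^sup>2" using eq by linarith
qed

lemma riesz_basis_biorthogonal:
  assumes riesz: "riesz_basis M I e" and j: "j \<in> I"
  shows "\<exists>g\<in>Ltwo M. \<forall>k\<in>I. inner2 M g (e k) = (if k = j then 1 else 0)"
proof -
  have e: "e i \<in> Ltwo M" if "i \<in> I" for i
    using riesz that by (auto simp: riesz_basis_def frame_def)
  obtain A B where "A > 0" "B > 0" and AB: "\<forall>f\<in>Ltwo M. (\<lambda>i. (cmod (inner2 M f (e i)))\<^sup>2) summable_on I \<and>
        A * (norm2 M f)\<^sup>2 \<le> (\<Sum>\<^sub>\<infinity>i\<in>I. (cmod (inner2 M f (e i)))\<^sup>2) \<and>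
        (\<Sum>\<^sub>\<infinity>i\<in>I. (cmod (inner2 M f (e i)))\<^sup>2) \<le> B * (norm2 M f)\<^sup>2"
    using riesz unfolding riesz_basis_def frame_def by blast
  define S where "S f = (\<Sum>\<^sub>\<infinity>i\<in>I - {j}. (cmod (inner2 M f (e i)))\<^sup>2)" for f
  note S = frame_remove_Bessel[OF AB j, folded S_def]
  have "\<exists>g\<in>Ltwo M. inner2 M g (e j) = 1 \<and> S g \<le> 2 / real (n + 2)" for n
  proof -
    \<comment> \<open>The shift by 2 gives \<open>A' \<le> A / 2\<close>: a vector violating the
      lower bound \<open>A'\<close> without \<open>e j\<close> then has more than half of
      \<open>A * (norm2 M f)\<^sup>2\<close> in its coefficient at \<open>j\<close>. This
      coefficient is nonzero, and dividing by it leaves at most \<open>2 / real (n + 2)\<close> in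
      all others.\<close>
    define A' where "A' = A / real (n + 2)"
    have A': "A' > 0" "A' \<le> A / 2" using \<open>A > 0\<close> by (auto simp: A'_def field_simps)
    have "\<not> frame M (I - {j}) e" using riesz j by (auto simp: riesz_basis_def)
    then have "\<exists>f\<in>Ltwo M. \<not> ((\<lambda>i. (cmod (inner2 M f (e i)))\<^sup>2) summable_on (I - {j}) \<and>
        A' * (norm2 M f)\<^sup>2 \<le> S f \<and> S f \<le> B * (norm2 M f)\<^sup>2)"
      using A' \<open>B > 0\<close> e unfolding frame_def S_def by blast
    then obtain f where f: "f \<in> Ltwo M" and Sf: "S f < A' * (norm2 M f)\<^sup>2"
      using S(1,3) by (auto simp: not_le)
    define b where "b = inner2 M f (e j)"
    have "A * (norm2 M f)\<^sup>2 \<le> S f + (cmod b)\<^sup>2" using S(2)[OF f] by (simp add: b_def)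
    moreover have "A' * (norm2 M f)\<^sup>2 \<le> A / 2 * (norm2 M f)\<^sup>2" 
      using A' by (intro mult_right_mono) auto
    ultimately have *: "A * (norm2 M f)\<^sup>2 < 2 * (cmod b)\<^sup>2" using Sf by simp
    moreover have "0 \<le> A * (norm2 M f)\<^sup>2" using \<open>A > 0\<close> by simp
    ultimately have b: "(cmod b)\<^sup>2 > 0" by linarith
    define g where "g = (\<lambda>x. inverse b * f x)"
    have g: "g \<in> Ltwo M" unfolding g_def using f by (rule Ltwo_cmult)
    have inner: "inner2 M g (e i) = inverse b * inner2 M f (e i)" for i
      unfolding g_def by (rule inner2_cmult_left)
    have "S g = (\<Sum>\<^sub>\<infinity>i\<in>I - {j}. (cmod (inverse b))\<^sup>2 * (cmod (inner2 M f (e i)))\<^sup>2)"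
      by (simp only: S_def inner norm_mult power_mult_distrib)
    also have "\<dots> = (cmod (inverse b))\<^sup>2 * S f"
      unfolding S_def by (rule infsum_cmult_right')
    also have "\<dots> = S f / (cmod b)\<^sup>2" by (simp add: norm_inverse power_inverse divide_inverse)
    also have "\<dots> \<le> (A' * (norm2 M f)\<^sup>2) / (cmod b)\<^sup>2"
      using Sf b by (intro divide_right_mono) auto
    also have "A' * (norm2 M f)\<^sup>2 \<le> (2 / real (n+2)) * (cmod b)\<^sup>2"
      using * by (simp add: A'_def divide_right_mono)
    then have "(A' * (norm2 M f)\<^sup>2) / (cmod b)\<^sup>2 \<le> 2 / real (n+2)"
      using b by (simp add: pos_divide_le_eq)
    finally show ?thesis using g b inner[of j] by (intro bexI[of _ g]) (auto simp: b_def)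
  qed
  then obtain G where G: "\<And>n. G n \<in> Ltwo M" "\<And>n. inner2 M (G n) (e j) = 1" "\<And>n. S (G n) \<le> 2 / real (n + 2)"
    by metis
  \<comment> \<open>Both vectors have coefficient 1 at \<open>j\<close>, which cancels in the
    difference, so the lower bound of the full frame is controlled by the remaining coefficients
    alone.\<close>
  have diff: "A * (norm2 M (\<lambda>x. G m x - G n x))\<^sup>2 \<le> 2 * S (G m) + 2 * S (G n)" for m n
  proof -
    have 1: "(\<lambda>x. G m x - G n x) \<in> Ltwo M" using G by (intro Ltwo_diff)
    have inner: "inner2 M (\<lambda>x. G m x - G n x) (e i) = inner2 M (G m) (e i) - inner2 M (G n) (e i)" if "i \<in> I" for i
      using G e that by (intro inner2_diff_left)
    have "S (\<lambda>x. G m x - G n x) \<le> (\<Sum>\<^sub>\<infinity>i\<in>I - {j}. 2 * (cmod (inner2 M (G m) (e i)))\<^sup>2 + 2 * (cmod (inner2 M (G n) (e i)))\<^sup>2)"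
      unfolding S_def
    proof (rule infsum_mono)
      show "(\<lambda>i. (cmod (inner2 M (\<lambda>x. G m x - G n x) (e i)))\<^sup>2) summable_on I - {j}" by (rule S(1)[OF 1])
      show "(\<lambda>i. 2 * (cmod (inner2 M (G m) (e i)))\<^sup>2 + 2 * (cmod (inner2 M (G n) (e i)))\<^sup>2) summable_on I - {j}"
        by (intro summable_on_add summable_on_cmult_right S(1) G)
      fix i assume "i \<in> I - {j}"
      then have "(cmod (inner2 M (\<lambda>x. G m x - G n x) (e i)))\<^sup>2 \<le> (cmod (inner2 M (G m) (e i)) + cmod (inner2 M (G n) (e i)))\<^sup>2"
        by (subst inner) (auto intro!: power_mono norm_triangle_ineq4)
      also have "\<dots> \<le> 2 * (cmod (inner2 M (G m) (e i)))\<^sup>2 + 2 * (cmod (inner2 M (G n) (e i)))\<^sup>2"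
        using sum_squares_bound[of "cmod (inner2 M (G m) (e i))" "cmod (inner2 M (G n) (e i))"] by (simp add: power2_sum)
      finally show "(cmod (inner2 M (\<lambda>x. G m x - G n x) (e i)))\<^sup>2 \<le> \<dots>" .
    qed
    also have "\<dots> = 2 * S (G m) + 2 * S (G n)"
      unfolding S_def infsum_cmult_right'[symmetric]
      by (intro infsum_add summable_on_cmult_right S(1) G)
    finally show ?thesis using S(2)[OF 1] inner[OF j] G(2) by simp
  qed
  have "\<exists>g. Ltwo_tendsto M G g"
  proof (rule Ltwo_complete[OF G(1)])
    fix r :: real assume r: "r > 0"
    \<comment> \<open>The 8 arises from \<open>diff\<close>: two terms, each twice a value that is
      at most \<open>2 / real (N + 2)\<close>.\<close>
    define N where "N = nat \<lceil>8 / (A * r\<^sup>2)\<rceil>"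
    have "8 / (A * r\<^sup>2) \<le> real N" unfolding N_def by linarith
    then have N: "8 \<le> real N * (A * r\<^sup>2)" using \<open>A > 0\<close> r by (simp add: field_simps)
    have "norm2 M (\<lambda>x. G m x - G n x) < r" if mn: "m \<ge> N" "n \<ge> N" for m n
    proof (rule power2_less_imp_less)
      have le: "2 / real (k + 2) \<le> 2 / real (N + 2)" if "k \<ge> N" for k
        using that by (intro divide_left_mono) auto
      have "A * (norm2 M (\<lambda>x. G m x - G n x))\<^sup>2 \<le> 8 / real (N + 2)"
        using diff[of m n] G(3)[of m] G(3)[of n] le[OF mn(1)] le[OF mn(2)] by simp
      also have "8 / real (N + 2) < A * r\<^sup>2"
      proof -
        have "0 < A * r\<^sup>2" using \<open>A > 0\<close> r by simp
        moreover have "(A * r\<^sup>2) * real (N + 2) = real N * (A * r\<^sup>2) + 2 * (A * r\<^sup>2)"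
          by (simp add: algebra_simps)
        ultimately have "8 < (A * r\<^sup>2) * real (N + 2)" using N by linarith
        then show ?thesis by (simp add: pos_divide_less_eq)
      qed
      finally show "(norm2 M (\<lambda>x. G m x - G n x))\<^sup>2 < r\<^sup>2" using \<open>A > 0\<close> by simp
    qed (use r in auto)
    then show "\<exists>N. \<forall>m\<ge>N. \<forall>n\<ge>N. norm2 M (\<lambda>x. G m x - G n x) < r" by blast
  qed
  then obtain g where lim: "Ltwo_tendsto M G g" by blast
  have "inner2 M g (e k) = (if k = j then 1 else 0)" if k: "k \<in> I" for k
  proof (cases "k = j")
    case True
    then show ?thesis using tendsto_inner2[OF lim e[OF k]] G(2) by (simp add: LIMSEQ_const_iff)
  next
    case False
    have "(cmod (inner2 M (G n) (e k)))\<^sup>2 \<le> 2 / real (n + 2)" for n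
    proof -
      have "(\<Sum>\<^sub>\<infinity>i\<in>{k}. (cmod (inner2 M (G n) (e i)))\<^sup>2) \<le> S (G n)"
        unfolding S_def using k False S(1)[OF G(1)] by (intro infsum_mono_neutral) auto
      then show ?thesis using G(3)[of n] by simp
    qed
    moreover have "(\<lambda>n. 2 / real (n + 2)) \<longlonglongrightarrow> 0"
      using LIMSEQ_ignore_initial_segment[OF lim_const_over_n[of "2::real"], of 2] by simp
    moreover have "(\<lambda>n. (cmod (inner2 M (G n) (e k)))\<^sup>2) \<longlonglongrightarrow> (cmod (inner2 M g (e k)))\<^sup>2"
      by (intro tendsto_intros tendsto_inner2[OF lim e[OF k]])
    ultimately have "(cmod (inner2 M g (e k)))\<^sup>2 \<le> 0"
      by (intro LIMSEQ_le[where X="\<lambda>n. (cmod (inner2 M (G n) (e k)))\<^sup>2" and Y="\<lambda>n. 2 / real (n + 2)"]) auto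
    then show ?thesis using False by simp
  qed
  moreover have "g \<in> Ltwo M" using lim by (simp add: Ltwo_tendsto_def)
  ultimately show ?thesis by blast
qed

section \<open>The Plancherel theorem\<close>

lemma borel_measurable_cis [measurable (raw)]:
  "f \<in> borel_measurable M \<Longrightarrow> (\<lambda>x. cis (f x)) \<in> borel_measurable M"
  by (rule measurable_compose[of f M borel cis borel])
     (auto intro!: borel_measurable_continuous_onI continuous_intros)

section \<open>Interchange of Fourier integrals\<close>

lemma integrable_mult_pair:
  fixes f g :: "real \<Rightarrow> complex"
  assumes f: "integrable lborel f" and g: "integrable lborel g"
  shows "integrable (lborel \<Otimes>\<^sub>M lborel) (\<lambda>(x, y). f x * g y)"
proof (rule lborel_pair.Fubini_integrable)
  note [measurable] = borel_measurable_integrable[OF f] borel_measurable_integrable[OF g]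
  show "(\<lambda>(x, y). f x * g y) \<in> borel_measurable (lborel \<Otimes>\<^sub>M lborel)" by measurable
  show "integrable lborel (\<lambda>x. \<integral>y. norm (case (x, y) of (x, y) \<Rightarrow> f x * g y) \<partial>lborel)"
    using integrable_norm[OF f] by (simp add: norm_mult)
  show "AE x in lborel. integrable lborel (\<lambda>y. case (x, y) of (x, y) \<Rightarrow> f x * g y)"
    using g by simp
qed

text \<open>Fubini with majorant \<open>C\<close> times the product of \<open>f\<close> and
  \<open>g\<close>. For an exponential kernel it is the multiplication formula of the Fourier
  transform.\<close>

lemma integral_kernel_swap:
  fixes f g :: "real \<Rightarrow> complex" and k :: "real \<Rightarrow> real \<Rightarrow> complex"
  assumes f: "integrable lborel f" and g: "integrable lborel g"
    and k[measurable]: "(\<lambda>(x, y). k x y) \<in> borel_measurable (borel \<Otimes>\<^sub>M borel)"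
    and bound: "\<And>x y. cmod (k x y) \<le> C"
  shows "(\<integral>x. f x * (\<integral>y. g y * k x y \<partial>lborel) \<partial>lborel) = (\<integral>y. g y * (\<integral>x. f x * k x y \<partial>lborel) \<partial>lborel)"
proof -
  note [measurable] = borel_measurable_integrable[OF f] borel_measurable_integrable[OF g]
  have "integrable (lborel \<Otimes>\<^sub>M lborel) (\<lambda>z. of_real C * (case z of (x, y) \<Rightarrow> f x * g y))"
    by (intro integrable_mult_right integrable_mult_pair f g)
  then have int: "integrable (lborel \<Otimes>\<^sub>M lborel) (\<lambda>(x, y). f x * g y * k x y)"
  proof (rule Bochner_Integration.integrable_bound)
    show "(\<lambda>(x, y). f x * g y * k x y) \<in> borel_measurable (lborel \<Otimes>\<^sub>M lborel)" by measurable
    have "cmod (f x * g y * k x y) \<le> cmod (of_real C * (f x * g y))" for x y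
      using mult_left_mono[OF order_trans[OF bound[of x y] abs_ge_self[of C]], of "cmod (f x * g y)"]
      by (simp add: norm_mult mult_ac)
    then show "AE z in lborel \<Otimes>\<^sub>M lborel. cmod (case z of (x, y) \<Rightarrow> f x * g y * k x y)
        \<le> cmod (of_real C * (case z of (x, y) \<Rightarrow> f x * g y))" by (intro AE_I2) auto
  qed
  have "(\<integral>x. f x * (\<integral>y. g y * k x y \<partial>lborel) \<partial>lborel) = (\<integral>x. (\<integral>y. f x * g y * k x y \<partial>lborel) \<partial>lborel)"
    by (simp only: mult.assoc integral_mult_right_zero)
  also have "\<dots> = (\<integral>y. (\<integral>x. f x * g y * k x y \<partial>lborel) \<partial>lborel)"
    using lborel_pair.Fubini_integral[of "\<lambda>x y. f x * g y * k x y"] int by simp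
  also have "\<dots> = (\<integral>y. (\<integral>x. g y * (f x * k x y) \<partial>lborel) \<partial>lborel)"
    by (simp only: mult_ac)
  also have "\<dots> = (\<integral>y. g y * (\<integral>x. f x * k x y \<partial>lborel) \<partial>lborel)"
    by (simp only: integral_mult_right_zero)
  finally show ?thesis .
qed

text \<open>A pointwise integral rather than an extension by continuity to
  \<open>Ltwo lborel\<close>, because its values at individual nodes are what sampling sees.\<close>

definition inv_fourier :: "(real \<Rightarrow> complex) \<Rightarrow> real \<Rightarrow> complex" where
  "inv_fourier G x = (\<integral>\<nu>. G \<nu> * cis (2 * pi * x * \<nu>) \<partial>lborel)"

lemma borel_measurable_inv_fourier [measurable (raw)]:
  assumes [measurable]: "(\<lambda>(t, \<nu>). G t \<nu>) \<in> borel_measurable (M \<Otimes>\<^sub>M borel)"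
    and [measurable]: "f \<in> borel_measurable M"
  shows "(\<lambda>t. inv_fourier (G t) (f t)) \<in> borel_measurable M"
  unfolding inv_fourier_def by measurable

lemma cmod_inv_fourier_le:
  "cmod (inv_fourier G x) \<le> (\<integral>\<nu>. cmod (G \<nu>) \<partial>lborel)"
  unfolding inv_fourier_def using integral_norm_bound[of lborel "\<lambda>\<nu>. G \<nu> * cis (2 * pi * x * \<nu>)"]
  by (simp add: norm_mult)

lemma integrable_mult_cis:
  fixes G :: "real \<Rightarrow> complex"
  assumes "integrable lborel G" shows "integrable lborel (\<lambda>\<nu>. G \<nu> * cis (a * \<nu>))"
proof -
  note [measurable] = borel_measurable_integrable[OF assms]
  show ?thesis
    by (rule Bochner_Integration.integrable_bound[OF assms]) (auto simp: norm_mult)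
qed

lemma inv_fourier_diff:
  assumes "integrable lborel F" "integrable lborel G"
  shows "inv_fourier (\<lambda>\<nu>. F \<nu> - G \<nu>) x = inv_fourier F x - inv_fourier G x"
  unfolding inv_fourier_def left_diff_distrib using assms 
  by (intro Bochner_Integration.integral_diff integrable_mult_cis)

section \<open>Gaussian damping and the Bessel inequality\<close>

text \<open>The substitution \<open>y = 2 * pi * \<sigma> * x\<close> reduces the integral to the
  characteristic function of the standard normal distribution. The result, as a function of
  \<open>d\<close>, is the normal density with deviation \<open>\<sigma>\<close>, an approximate
  identity for small \<open>\<sigma>\<close>.\<close>

lemma integral_gaussian_cis:
  assumes "\<sigma> > 0"
  shows "integrable lborel (\<lambda>x. complex_of_real (exp (- (2 * pi * \<sigma> * x)\<^sup>2 / 2)))"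
    and "(\<integral>x. complex_of_real (exp (- (2 * pi * \<sigma> * x)\<^sup>2 / 2)) * cis (2 * pi * x * d) \<partial>lborel) =
         complex_of_real (std_normal_density (d / \<sigma>) / \<sigma>)"
proof -
  define c where "c = 2 * pi * \<sigma>"
  have c: "c > 0" using assms by (simp add: c_def)
  have dens: "exp (- x\<^sup>2 / 2) = sqrt (2 * pi) * std_normal_density x" for x
    by (simp add: std_normal_density_def)
  have "integrable lborel (\<lambda>x::real. exp (- x\<^sup>2 / 2))"
    unfolding dens by (intro integrable_mult_right integrable_normal_density) auto
  then have "integrable lborel (\<lambda>x. exp (- (0 + c * x)\<^sup>2 / 2))"
    using c by (intro lborel_integrable_real_affine) auto
  then have "integrable lborel (\<lambda>x. complex_of_real (exp (- (0 + c * x)\<^sup>2 / 2)))"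
    by (rule integrable_of_real)
  then show "integrable lborel (\<lambda>x. complex_of_real (exp (- (2 * pi * \<sigma> * x)\<^sup>2 / 2)))"
    by (simp add: c_def)
  have "complex_of_real (exp (- ((d / \<sigma>)\<^sup>2) / 2)) = char std_normal_distribution (d / \<sigma>)"
    by (simp add: char_std_normal_distribution)
  also have "\<dots> = (\<integral>y. std_normal_density y *\<^sub>R cis (d / \<sigma> * y) \<partial>lborel)"
    unfolding char_def by (subst integral_density) (auto simp: cis_conv_exp)
  also have "\<dots> = c *\<^sub>R (\<integral>x. std_normal_density (0 + c * x) *\<^sub>R cis (d / \<sigma> * (0 + c * x)) \<partial>lborel)"
    using lborel_integral_real_affine[of c "\<lambda>y. std_normal_density y *\<^sub>R cis (d / \<sigma> * y)" 0] c by simp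
  also have "\<dots> = c *\<^sub>R (\<integral>x. of_real (1 / sqrt (2 * pi)) * (complex_of_real (exp (- (2 * pi * \<sigma> * x)\<^sup>2 / 2)) * cis (2 * pi * x * d)) \<partial>lborel)"
    using assms by (intro arg_cong[where f="\<lambda>x. c *\<^sub>R x"] Bochner_Integration.integral_cong)
      (auto simp: std_normal_density_def c_def scaleR_conv_of_real mult_ac)
  also have "\<dots> = of_real (c / sqrt (2 * pi)) * (\<integral>x. complex_of_real (exp (- (2 * pi * \<sigma> * x)\<^sup>2 / 2)) * cis (2 * pi * x * d) \<partial>lborel)"
    by (subst integral_mult_right_zero) (simp add: scaleR_conv_of_real)
  finally have "(\<integral>x. complex_of_real (exp (- (2 * pi * \<sigma> * x)\<^sup>2 / 2)) * cis (2 * pi * x * d) \<partial>lborel) =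
     of_real (sqrt (2 * pi) / c) * complex_of_real (exp (- ((d / \<sigma>)\<^sup>2) / 2))"
    using c by (simp add: field_simps)
  also have "\<dots> = complex_of_real (sqrt (2 * pi) / c * exp (- ((d / \<sigma>)\<^sup>2) / 2))" by simp
  also have "sqrt (2 * pi) / c * exp (- ((d / \<sigma>)\<^sup>2) / 2) = std_normal_density (d / \<sigma>) / \<sigma>"
  proof -
    have "sqrt (2 * pi) * sqrt (2 * pi) = 2 * pi" by simp
    then have "sqrt (2 * pi) / c = 1 / sqrt (2 * pi) / \<sigma>"
      using assms unfolding c_def by (simp add: field_simps)
    then show ?thesis by (simp add: std_normal_density_def)
  qed
  finally show "(\<integral>x. complex_of_real (exp (- (2 * pi * \<sigma> * x)\<^sup>2 / 2)) * cis (2 * pi * x * d) \<partial>lborel) =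
         complex_of_real (std_normal_density (d / \<sigma>) / \<sigma>)" .
qed

text \<open>An integrable \<open>G\<close> has merely a bounded inverse transform; the Gaussian
  weight restores absolute convergence, and two applications of Fubini become legitimate. The
  weighted energy is then the pairing of \<open>G\<close> with its average under normal
  displacements of deviation \<open>\<sigma>\<close>; the limit \<open>\<sigma> = 0\<close> is
  formally the Plancherel identity.\<close>

lemma gaussian_Plancherel:
  assumes G: "integrable lborel G" and \<sigma>: "\<sigma> > 0"
  shows "integrable lborel (\<lambda>x. exp (- (2 * pi * \<sigma> * x)\<^sup>2 / 2) * (cmod (inv_fourier G x))\<^sup>2)"
    and "complex_of_real (\<integral>x. exp (- (2 * pi * \<sigma> * x)\<^sup>2 / 2) * (cmod (inv_fourier G x))\<^sup>2 \<partial>lborel) =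
      (\<integral>\<nu>. G \<nu> * (\<integral>z. cnj (G (\<nu> + \<sigma> * z)) * complex_of_real (std_normal_density z) \<partial>lborel) \<partial>lborel)"
proof -
  note [measurable] = borel_measurable_integrable[OF G]
  define w where "w x = complex_of_real (exp (- (2 * pi * \<sigma> * x)\<^sup>2 / 2))" for x
  define K where "K = (\<integral>\<nu>. cmod (G \<nu>) \<partial>lborel)"
  have K: "cmod (inv_fourier G x) \<le> K" for x unfolding K_def by (rule cmod_inv_fourier_le)
  have w_int: "integrable lborel w" unfolding w_def by (rule integral_gaussian_cis(1)[OF \<sigma>])
  have [measurable]: "w \<in> borel_measurable borel" unfolding w_def by measurable
  have wphi: "integrable lborel (\<lambda>x. w x * cnj (inv_fourier G x))"
  proof (rule Bochner_Integration.integrable_bound[OF integrable_mult_right[OF w_int, of "of_real K"]])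
    have "cmod (w x * cnj (inv_fourier G x)) \<le> cmod (of_real K * w x)" for x
      using mult_right_mono[OF order_trans[OF K[of x] abs_ge_self], of "cmod (w x)"]
      by (simp add: norm_mult mult.commute)
    then show "AE x in lborel. cmod (w x * cnj (inv_fourier G x)) \<le> cmod (of_real K * w x)" by simp
  qed measurable
  have "integrable lborel (\<lambda>x. K * (K * cmod (w x)))" using integrable_norm[OF w_int] by auto
  then show "integrable lborel (\<lambda>x. exp (- (2 * pi * \<sigma> * x)\<^sup>2 / 2) * (cmod (inv_fourier G x))\<^sup>2)"
  proof (rule Bochner_Integration.integrable_bound)
    have "norm (exp (- (2 * pi * \<sigma> * x)\<^sup>2 / 2) * (cmod (inv_fourier G x))\<^sup>2) \<le> norm (K * (K * cmod (w x)))" for x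
    proof -
      have "(cmod (inv_fourier G x))\<^sup>2 \<le> K * K"
        unfolding power2_eq_square using K[of x] by (intro mult_mono) (auto intro: order_trans[OF _ K])
      from mult_left_mono[OF this, of "cmod (w x)"] show ?thesis
        by (simp add: w_def abs_mult mult.commute mult.assoc)
    qed
    then show "AE x in lborel. norm (exp (- (2 * pi * \<sigma> * x)\<^sup>2 / 2) * (cmod (inv_fourier G x))\<^sup>2) \<le> norm (K * (K * cmod (w x)))"
      by simp
  qed measurable
  have cnj_phi: "cnj (inv_fourier G x) = (\<integral>\<mu>. cnj (G \<mu>) * cis (- (2 * pi * x * \<mu>)) \<partial>lborel)" for x
    unfolding inv_fourier_def Bochner_Integration.integral_cnj[symmetric] by (simp add: cis_cnj)
  \<comment> \<open>Fubini produces a convolution with the normal density of deviation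
    \<open>\<sigma>\<close>. Substituting \<open>\<mu> = \<nu> + \<sigma> * z\<close> moves
    \<open>\<sigma>\<close> into the argument of \<open>G\<close>; the density is then taken at
    \<open>- z\<close> and is even.\<close>
  have inner: "(\<integral>x. w x * cnj (inv_fourier G x) * cis (2 * pi * x * \<nu>) \<partial>lborel) = 
     (\<integral>z. cnj (G (\<nu> + \<sigma> * z)) * complex_of_real (std_normal_density z) \<partial>lborel)" for \<nu>
  proof -
    have "(\<integral>x. w x * cnj (inv_fourier G x) * cis (2 * pi * x * \<nu>) \<partial>lborel) = 
        (\<integral>x. (w x * cis (2 * pi * \<nu> * x)) * (\<integral>\<mu>. cnj (G \<mu>) * cis (- (2 * pi * x * \<mu>)) \<partial>lborel) \<partial>lborel)"
      unfolding cnj_phi by (simp add: mult_ac)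
    also have "\<dots> = (\<integral>\<mu>. cnj (G \<mu>) * (\<integral>x. (w x * cis (2 * pi * \<nu> * x)) * cis (- (2 * pi * x * \<mu>)) \<partial>lborel) \<partial>lborel)"
      by (rule integral_kernel_swap[where C=1]) (use G in \<open>auto intro: integrable_mult_cis[OF w_int]\<close>)
    also have "\<dots> = (\<integral>\<mu>. cnj (G \<mu>) * complex_of_real (std_normal_density ((\<nu> - \<mu>) / \<sigma>) / \<sigma>) \<partial>lborel)"
    proof -
      have "(w x * cis (2 * pi * \<nu> * x)) * cis (- (2 * pi * x * \<mu>)) = w x * cis (2 * pi * x * (\<nu> - \<mu>))" for x \<mu>
        by (simp add: mult.assoc cis_mult algebra_simps)
      then show ?thesis by (simp only: integral_gaussian_cis(2)[OF \<sigma>, folded w_def])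
    qed
    also have "\<dots> = \<sigma> *\<^sub>R (\<integral>z. cnj (G (\<nu> + \<sigma> * z)) * complex_of_real (std_normal_density ((\<nu> - (\<nu> + \<sigma> * z)) / \<sigma>) / \<sigma>) \<partial>lborel)"
      using lborel_integral_real_affine[of \<sigma> "\<lambda>\<mu>. cnj (G \<mu>) * complex_of_real (std_normal_density ((\<nu> - \<mu>) / \<sigma>) / \<sigma>)" \<nu>] \<sigma> by simp
    also have "\<dots> = (\<integral>z. \<sigma> *\<^sub>R (cnj (G (\<nu> + \<sigma> * z)) * complex_of_real (std_normal_density ((\<nu> - (\<nu> + \<sigma> * z)) / \<sigma>) / \<sigma>)) \<partial>lborel)"
      by (rule integral_scaleR_right[symmetric])
    also have "\<dots> = (\<integral>z. cnj (G (\<nu> + \<sigma> * z)) * complex_of_real (std_normal_density z) \<partial>lborel)"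
    proof (rule Bochner_Integration.integral_cong[OF refl])
      fix z
      have "std_normal_density ((\<nu> - (\<nu> + \<sigma> * z)) / \<sigma>) = std_normal_density z"
        using \<sigma> by (simp add: std_normal_density_def)
      then show "\<sigma> *\<^sub>R (cnj (G (\<nu> + \<sigma> * z)) * complex_of_real (std_normal_density ((\<nu> - (\<nu> + \<sigma> * z)) / \<sigma>) / \<sigma>)) =
        cnj (G (\<nu> + \<sigma> * z)) * complex_of_real (std_normal_density z)"
        using \<sigma> by (simp add: scaleR_conv_of_real)
    qed
    finally show ?thesis .
  qed
  have "complex_of_real (\<integral>x. exp (- (2 * pi * \<sigma> * x)\<^sup>2 / 2) * (cmod (inv_fourier G x))\<^sup>2 \<partial>lborel) =
      (\<integral>x. (w x * cnj (inv_fourier G x)) * (\<integral>\<nu>. G \<nu> * cis (2 * pi * x * \<nu>) \<partial>lborel) \<partial>lborel)"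
    unfolding integral_complex_of_real[symmetric] inv_fourier_def[symmetric] w_def
    by (intro Bochner_Integration.integral_cong) (auto simp: complex_norm_square mult_ac simp del: of_real_power)
  also have "\<dots> = (\<integral>\<nu>. G \<nu> * (\<integral>x. (w x * cnj (inv_fourier G x)) * cis (2 * pi * x * \<nu>) \<partial>lborel) \<partial>lborel)"
    by (rule integral_kernel_swap[where C=1]) (use G wphi in auto)
  also have "\<dots> = (\<integral>\<nu>. G \<nu> * (\<integral>z. cnj (G (\<nu> + \<sigma> * z)) * complex_of_real (std_normal_density z) \<partial>lborel) \<partial>lborel)"
    unfolding inner ..
  finally show "complex_of_real (\<integral>x. exp (- (2 * pi * \<sigma> * x)\<^sup>2 / 2) * (cmod (inv_fourier G x))\<^sup>2 \<partial>lborel) = \<dots>" .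
qed

text \<open>A non-integrable function has integral 0 by convention, so the estimate holds without
  any integrability condition.\<close>

lemma norm_integral_le_nn_integral:
  fixes f :: "'a \<Rightarrow> 'b::{banach, second_countable_topology}"
  shows "ennreal (norm (\<integral>x. f x \<partial>M)) \<le> (\<integral>\<^sup>+x. ennreal (norm (f x)) \<partial>M)"
  by (cases "integrable M f") (auto simp: integral_norm_bound_ennreal not_integrable_integral_eq)

lemma nn_integral_std_normal_density: "(\<integral>\<^sup>+z. ennreal (std_normal_density z) \<partial>lborel) = 1"
  by (subst nn_integral_eq_integral) (auto simp: integrable_normal_density integral_normal_density)

text \<open>The product of the two values of \<open>G\<close> is at most half the sum of their
  squares. After Tonelli, translation invariance in \<open>\<nu>\<close> gives both squares the same
  integral, and the normal density has mass 1; the bound is therefore uniform in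
  \<open>\<sigma>\<close>.\<close>

lemma gaussian_Bessel:
  assumes G: "integrable lborel G" "G \<in> Ltwo lborel" and \<sigma>: "\<sigma> > 0"
  shows "(\<integral>\<^sup>+x. ennreal (exp (- (2 * pi * \<sigma> * x)\<^sup>2 / 2) * (cmod (inv_fourier G x))\<^sup>2) \<partial>lborel)
    \<le> ennreal ((norm2 lborel G)\<^sup>2)"
proof -
  note [measurable] = borel_measurable_integrable[OF G(1)]
  let ?n = std_normal_density and ?N = "ennreal ((norm2 lborel G)\<^sup>2)"
  let ?I = "\<integral>x. exp (- (2 * pi * \<sigma> * x)\<^sup>2 / 2) * (cmod (inv_fourier G x))\<^sup>2 \<partial>lborel"
  have "?I \<ge> 0" by (rule Bochner_Integration.integral_nonneg) auto
  have "(\<integral>\<^sup>+x. ennreal (exp (- (2 * pi * \<sigma> * x)\<^sup>2 / 2) * (cmod (inv_fourier G x))\<^sup>2) \<partial>lborel) = ennreal ?I"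
    by (rule nn_integral_eq_integral[OF gaussian_Plancherel(1)[OF G(1) \<sigma>]]) auto
  also have "\<dots> = ennreal (cmod (complex_of_real ?I))" using \<open>?I \<ge> 0\<close> by simp
  also have "\<dots> = ennreal (cmod (\<integral>\<nu>. G \<nu> * (\<integral>z. cnj (G (\<nu> + \<sigma> * z)) * complex_of_real (?n z) \<partial>lborel) \<partial>lborel))"
    by (simp only: gaussian_Plancherel(2)[OF G(1) \<sigma>])
  also have "\<dots> \<le> (\<integral>\<^sup>+\<nu>. ennreal (cmod (G \<nu> * (\<integral>z. cnj (G (\<nu> + \<sigma> * z)) * complex_of_real (?n z) \<partial>lborel))) \<partial>lborel)"
    by (rule norm_integral_le_nn_integral)
  also have "\<dots> \<le> (\<integral>\<^sup>+\<nu>. (\<integral>\<^sup>+z. ennreal (?n z * (1/2 * (cmod (G \<nu>))\<^sup>2 + 1/2 * (cmod (G (\<nu> + \<sigma> * z)))\<^sup>2)) \<partial>lborel) \<partial>lborel)"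
  proof (rule nn_integral_mono)
    fix \<nu>
    have "ennreal (cmod (G \<nu> * (\<integral>z. cnj (G (\<nu> + \<sigma> * z)) * complex_of_real (?n z) \<partial>lborel)))
      = ennreal (cmod (\<integral>z. G \<nu> * (cnj (G (\<nu> + \<sigma> * z)) * complex_of_real (?n z)) \<partial>lborel))"
      by simp
    also have "\<dots> \<le> (\<integral>\<^sup>+z. ennreal (cmod (G \<nu> * (cnj (G (\<nu> + \<sigma> * z)) * complex_of_real (?n z)))) \<partial>lborel)"
      by (rule norm_integral_le_nn_integral)
    also have "\<dots> \<le> (\<integral>\<^sup>+z. ennreal (?n z * (1/2 * (cmod (G \<nu>))\<^sup>2 + 1/2 * (cmod (G (\<nu> + \<sigma> * z)))\<^sup>2)) \<partial>lborel)"
    proof (intro nn_integral_mono ennreal_leI)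
      fix z
      have "cmod (G \<nu>) * cmod (G (\<nu> + \<sigma> * z)) \<le> 1/2 * (cmod (G \<nu>))\<^sup>2 + 1/2 * (cmod (G (\<nu> + \<sigma> * z)))\<^sup>2"
        using sum_squares_bound[of "cmod (G \<nu>)" "cmod (G (\<nu> + \<sigma> * z))"] by simp
      from mult_left_mono[OF this, of "?n z"]
      show "cmod (G \<nu> * (cnj (G (\<nu> + \<sigma> * z)) * complex_of_real (?n z))) \<le> ?n z * (1/2 * (cmod (G \<nu>))\<^sup>2 + 1/2 * (cmod (G (\<nu> + \<sigma> * z)))\<^sup>2)"
        by (simp add: norm_mult mult_ac)
    qed
    finally show "ennreal (cmod (G \<nu> * (\<integral>z. cnj (G (\<nu> + \<sigma> * z)) * complex_of_real (?n z) \<partial>lborel))) \<le> \<dots>" .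
  qed
  also have "\<dots> = (\<integral>\<^sup>+z. (\<integral>\<^sup>+\<nu>. ennreal (?n z * (1/2 * (cmod (G \<nu>))\<^sup>2 + 1/2 * (cmod (G (\<nu> + \<sigma> * z)))\<^sup>2)) \<partial>lborel) \<partial>lborel)"
    by (rule lborel_pair.Fubini') measurable
  also have "\<dots> = (\<integral>\<^sup>+z. ?N * ennreal (?n z) \<partial>lborel)"
  proof (rule nn_integral_cong)
    fix z
    have split: "ennreal (a * (1/2 * b + 1/2 * c)) = ennreal a * (ennreal (1/2) * ennreal b + ennreal (1/2) * ennreal c)"
      if "0 \<le> a" "0 \<le> b" "0 \<le> c" for a b c
    proof -
      have "ennreal (1/2 * b + 1/2 * c) = ennreal (1/2 * b) + ennreal (1/2 * c)"
        using that by (intro ennreal_plus) auto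
      also have "ennreal (1/2 * b) = ennreal (1/2) * ennreal b" using that by (intro ennreal_mult) auto
      also have "ennreal (1/2 * c) = ennreal (1/2) * ennreal c" using that by (intro ennreal_mult) auto
      finally show ?thesis using that by (subst ennreal_mult) auto
    qed
    \<comment> \<open>The argument is written as \<open>\<sigma> * z + 1 * \<nu>\<close> to fit the
      affine substitution rule with slope 1.\<close>
    have "(\<integral>\<^sup>+\<nu>. ennreal (?n z * (1/2 * (cmod (G \<nu>))\<^sup>2 + 1/2 * (cmod (G (\<nu> + \<sigma> * z)))\<^sup>2)) \<partial>lborel)
      = (\<integral>\<^sup>+\<nu>. ennreal (?n z) * (ennreal (1/2) * ennreal ((cmod (G \<nu>))\<^sup>2) + ennreal (1/2) * ennreal ((cmod (G (\<sigma> * z + 1 * \<nu>)))\<^sup>2)) \<partial>lborel)"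
    proof (rule nn_integral_cong)
      show "ennreal (?n z * (1/2 * (cmod (G \<nu>))\<^sup>2 + 1/2 * (cmod (G (\<nu> + \<sigma> * z)))\<^sup>2))
        = ennreal (?n z) * (ennreal (1/2) * ennreal ((cmod (G \<nu>))\<^sup>2) + ennreal (1/2) * ennreal ((cmod (G (\<sigma> * z + 1 * \<nu>)))\<^sup>2))" for \<nu>
        by (subst split) (auto simp: add.commute)
    qed
    also have "\<dots> = ennreal (?n z) * (ennreal (1/2) * (\<integral>\<^sup>+\<nu>. ennreal ((cmod (G \<nu>))\<^sup>2) \<partial>lborel) + 
        ennreal (1/2) * (\<integral>\<^sup>+\<nu>. ennreal ((cmod (G (\<sigma> * z + 1 * \<nu>)))\<^sup>2) \<partial>lborel))"
      by (simp add: nn_integral_cmult nn_integral_add)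
    also have "(\<integral>\<^sup>+\<nu>. ennreal ((cmod (G (\<sigma> * z + 1 * \<nu>)))\<^sup>2) \<partial>lborel) = (\<integral>\<^sup>+\<nu>. ennreal ((cmod (G \<nu>))\<^sup>2) \<partial>lborel)"
      using nn_integral_real_affine[of "\<lambda>\<nu>. ennreal ((cmod (G \<nu>))\<^sup>2)" 1 "\<sigma> * z"] by simp
    also have "ennreal (?n z) * (ennreal (1/2) * (\<integral>\<^sup>+\<nu>. ennreal ((cmod (G \<nu>))\<^sup>2) \<partial>lborel) + 
        ennreal (1/2) * (\<integral>\<^sup>+\<nu>. ennreal ((cmod (G \<nu>))\<^sup>2) \<partial>lborel)) = ?N * ennreal (?n z)"
      unfolding nn_integral_norm2[OF G(2)] by (subst split[symmetric]) (auto simp: ennreal_mult mult.commute)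
    finally show "(\<integral>\<^sup>+\<nu>. ennreal (?n z * (1/2 * (cmod (G \<nu>))\<^sup>2 + 1/2 * (cmod (G (\<nu> + \<sigma> * z)))\<^sup>2)) \<partial>lborel) = ?N * ennreal (?n z)" .
  qed
  also have "\<dots> = ?N"
    by (simp add: nn_integral_cmult nn_integral_std_normal_density)
  finally show ?thesis .
qed

lemma gaussian_weight_tendsto:
  "(\<lambda>n. exp (- (2 * pi * (1 / real (Suc n)) * x)\<^sup>2 / 2)) \<longlonglongrightarrow> 1"
proof -
  have "(\<lambda>n. exp (- (2 * pi * (1 / real (Suc n)) * x)\<^sup>2 / 2)) \<longlonglongrightarrow> exp (- (2 * pi * 0 * x)\<^sup>2 / 2)"
    by (intro tendsto_intros LIMSEQ_Suc lim_1_over_n) auto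
  then show ?thesis by simp
qed

text \<open>Fatou's lemma as the Gaussian weights increase to 1. This half of Plancherel puts the
  transform into \<open>Ltwo lborel\<close> and makes it continuous there, which lets equality
  spread from a dense class.\<close>

lemma inv_fourier_Bessel:
  assumes G: "integrable lborel G" "G \<in> Ltwo lborel"
  shows "inv_fourier G \<in> Ltwo lborel" and "norm2 lborel (inv_fourier G) \<le> norm2 lborel G"
proof -
  note [measurable] = borel_measurable_integrable[OF G(1)]
  let ?w = "\<lambda>n x. exp (- (2 * pi * (1 / real (Suc n)) * x)\<^sup>2 / 2) * (cmod (inv_fourier G x))\<^sup>2"
  have "(\<integral>\<^sup>+x. ennreal ((cmod (inv_fourier G x))\<^sup>2) \<partial>lborel) = (\<integral>\<^sup>+x. liminf (\<lambda>n. ennreal (?w n x)) \<partial>lborel)"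
  proof (rule nn_integral_cong)
    fix x
    have "(\<lambda>n. ennreal (?w n x)) \<longlonglongrightarrow> ennreal (1 * (cmod (inv_fourier G x))\<^sup>2)"
      by (intro tendsto_ennrealI tendsto_mult gaussian_weight_tendsto tendsto_const)
    from lim_imp_Liminf[OF trivial_limit_sequentially this]
    show "ennreal ((cmod (inv_fourier G x))\<^sup>2) = liminf (\<lambda>n. ennreal (?w n x))" by simp
  qed
  also have "\<dots> \<le> liminf (\<lambda>n. \<integral>\<^sup>+x. ennreal (?w n x) \<partial>lborel)"
    by (rule nn_integral_liminf) measurable
  also have "\<dots> \<le> liminf (\<lambda>n::nat. ennreal ((norm2 lborel G)\<^sup>2))"
    by (intro Liminf_mono always_eventually allI gaussian_Bessel G) auto
  also have "\<dots> = ennreal ((norm2 lborel G)\<^sup>2)" by (simp add: Liminf_const)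
  finally have le: "(\<integral>\<^sup>+x. ennreal ((cmod (inv_fourier G x))\<^sup>2) \<partial>lborel) \<le> ennreal ((norm2 lborel G)\<^sup>2)" .
  show "inv_fourier G \<in> Ltwo lborel" "norm2 lborel (inv_fourier G) \<le> norm2 lborel G"
    by (rule nn_integral_le_imp_Ltwo[OF _ le]; simp)+
qed

section \<open>Plancherel for continuous functions of compact support\<close>

lemma continuous_compact_support:
  fixes G :: "real \<Rightarrow> complex"
  assumes cont: "continuous_on UNIV G" and supp: "\<forall>x. \<bar>x\<bar> > L \<longrightarrow> G x = 0"
  shows "\<exists>C. \<forall>x. cmod (G x) \<le> C" and "integrable lborel G" and "G \<in> Ltwo lborel"
proof -
  have "compact (G ` {-L..L})"
    by (intro compact_continuous_image continuous_on_subset[OF cont]) auto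
  then have "\<exists>C. \<forall>x\<in>{-L..L}. cmod (G x) \<le> C"
    by (auto dest!: compact_imp_bounded simp: bounded_iff)
  then obtain C where C: "\<And>x. x \<in> {-L..L} \<Longrightarrow> cmod (G x) \<le> C" by blast
  have C': "cmod (G x) \<le> \<bar>C\<bar> * indicator {-L..L} x" for x
  proof (cases "x \<in> {-L..L}")
    case True then show ?thesis using C[OF True] by simp
  next
    case False then show ?thesis using supp by auto
  qed
  have "cmod (G x) \<le> \<bar>C\<bar>" for x using C'[of x] by (auto split: split_indicator_asm)
  then show "\<exists>C. \<forall>x. cmod (G x) \<le> C" by blast
  have [measurable]: "G \<in> borel_measurable borel" using cont by (rule borel_measurable_continuous_onI)
  have int: "integrable lborel (\<lambda>x. D * indicator {-L..L} x :: real)" for D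
    by (intro integrable_mult_right integrable_real_indicator) (auto simp: emeasure_lborel_Icc_eq)
  show "integrable lborel G"
    by (rule Bochner_Integration.integrable_bound[OF int[of "\<bar>C\<bar>"]]) (use C' in auto)
  have sq: "(cmod (G x))\<^sup>2 \<le> C\<^sup>2 * indicator {-L..L} x" for x
    using power_mono[OF C'[of x] norm_ge_zero, of 2] by (auto simp: power_mult_distrib split: split_indicator)
  have "integrable lborel (\<lambda>x. (cmod (G x))\<^sup>2)"
    by (rule Bochner_Integration.integrable_bound[OF int[of "C\<^sup>2"]]) (use sq in auto)
  then show "G \<in> Ltwo lborel" by (simp add: Ltwo_def)
qed

text \<open>Both sides of the Gaussian identity have limits. Continuity makes the averages of
  \<open>G\<close> converge pointwise, dominated by the bound \<open>C\<close>; on the transform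
  side the Bessel inequality has already supplied an integrable majorant.\<close>

lemma Plancherel_continuous:
  assumes cont: "continuous_on UNIV G" and supp: "\<forall>x. \<bar>x\<bar> > L \<longrightarrow> G x = 0"
  shows "norm2 lborel (inv_fourier G) = norm2 lborel G"
proof -
  note G = continuous_compact_support(2,3)[OF cont supp]
  note [measurable] = borel_measurable_integrable[OF G(1)]
  obtain C where C: "\<And>x. cmod (G x) \<le> C" using continuous_compact_support(1)[OF cont supp] by blast
  let ?\<sigma> = "\<lambda>n. 1 / real (Suc n)" and ?n = std_normal_density
  let ?J = "\<lambda>n \<nu>. \<integral>z. cnj (G (\<nu> + ?\<sigma> n * z)) * complex_of_real (?n z) \<partial>lborel"
  have n_int: "integrable lborel (\<lambda>z. complex_of_real (?n z))" by (intro integrable_of_real integrable_normal_density) auto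
  have dom: "integrable lborel (\<lambda>z. C * ?n z)" by (intro integrable_mult_right integrable_normal_density) auto
  have J: "(\<lambda>n. ?J n \<nu>) \<longlonglongrightarrow> cnj (G \<nu>)" for \<nu>
  proof -
    have "(\<lambda>n. ?J n \<nu>) \<longlonglongrightarrow> (\<integral>z. cnj (G \<nu>) * complex_of_real (?n z) \<partial>lborel)"
    proof (rule integral_dominated_convergence[where w="\<lambda>z. C * ?n z", OF _ _ dom])
      show "AE z in lborel. (\<lambda>n. cnj (G (\<nu> + ?\<sigma> n * z)) * complex_of_real (?n z)) \<longlonglongrightarrow> cnj (G \<nu>) * complex_of_real (?n z)"
      proof (intro AE_I2 tendsto_intros)
        fix z
        have "(\<lambda>n. \<nu> + ?\<sigma> n * z) \<longlonglongrightarrow> \<nu> + 0 * z"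
          by (intro tendsto_intros LIMSEQ_Suc lim_1_over_n)
        then show "(\<lambda>n. G (\<nu> + ?\<sigma> n * z)) \<longlonglongrightarrow> G \<nu>"
          using continuous_on_tendsto_compose[OF cont, of "\<lambda>n. \<nu> + ?\<sigma> n * z" \<nu> sequentially] by simp
      qed
      show "AE z in lborel. norm (cnj (G (\<nu> + ?\<sigma> n * z)) * complex_of_real (?n z)) \<le> C * ?n z" for n
        using C by (intro AE_I2) (simp add: norm_mult mult_right_mono)
    qed measurable
    also have "(\<integral>z. cnj (G \<nu>) * complex_of_real (?n z) \<partial>lborel) = cnj (G \<nu>)"
      by (simp add: integral_normal_density)
    finally show ?thesis .
  qed
  have Jbound: "cmod (?J n \<nu>) \<le> C" for n \<nu>
  proof -
    have le: "cmod (cnj (G (\<nu> + ?\<sigma> n * z)) * complex_of_real (?n z)) \<le> C * ?n z" for z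
      using C by (simp add: norm_mult mult_right_mono)
    have "integrable lborel (\<lambda>z. cnj (G (\<nu> + ?\<sigma> n * z)) * complex_of_real (?n z))"
    proof (rule Bochner_Integration.integrable_bound[OF dom])
      show "AE z in lborel. cmod (cnj (G (\<nu> + ?\<sigma> n * z)) * complex_of_real (?n z)) \<le> norm (C * ?n z)"
        by (intro AE_I2 order_trans[OF le]) simp
    qed measurable
    then have "cmod (?J n \<nu>) \<le> (\<integral>z. C * ?n z \<partial>lborel)"
      by (rule Bochner_Integration.integral_norm_bound_integral[OF _ dom]) (rule le)
    then show ?thesis by (simp add: integral_normal_density)
  qed
  have "(\<lambda>n. \<integral>\<nu>. G \<nu> * ?J n \<nu> \<partial>lborel) \<longlonglongrightarrow> (\<integral>\<nu>. G \<nu> * cnj (G \<nu>) \<partial>lborel)"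
  proof (rule integral_dominated_convergence[where w="\<lambda>\<nu>. cmod (G \<nu>) * C"])
    show "integrable lborel (\<lambda>\<nu>. cmod (G \<nu>) * C)" using G by auto
    show "AE \<nu> in lborel. (\<lambda>n. G \<nu> * ?J n \<nu>) \<longlonglongrightarrow> G \<nu> * cnj (G \<nu>)"
      by (intro AE_I2 tendsto_mult tendsto_const J)
    show "AE \<nu> in lborel. norm (G \<nu> * ?J n \<nu>) \<le> cmod (G \<nu>) * C" for n
      unfolding norm_mult by (intro AE_I2 mult_left_mono Jbound) auto
  qed measurable
  moreover have "(\<integral>\<nu>. G \<nu> * cnj (G \<nu>) \<partial>lborel) = complex_of_real ((norm2 lborel G)\<^sup>2)"
    unfolding norm2_squared integral_complex_of_real[symmetric] by (simp only: complex_norm_square)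
  moreover have "complex_of_real (\<integral>x. exp (- (2 * pi * ?\<sigma> n * x)\<^sup>2 / 2) * (cmod (inv_fourier G x))\<^sup>2 \<partial>lborel)
      = (\<integral>\<nu>. G \<nu> * ?J n \<nu> \<partial>lborel)" for n
    by (rule gaussian_Plancherel(2)[OF G(1)]) simp
  ultimately have "(\<lambda>n. complex_of_real (\<integral>x. exp (- (2 * pi * ?\<sigma> n * x)\<^sup>2 / 2) * (cmod (inv_fourier G x))\<^sup>2 \<partial>lborel))
      \<longlonglongrightarrow> complex_of_real ((norm2 lborel G)\<^sup>2)"
    by (simp only:)
  then have lim1: "(\<lambda>n. \<integral>x. exp (- (2 * pi * ?\<sigma> n * x)\<^sup>2 / 2) * (cmod (inv_fourier G x))\<^sup>2 \<partial>lborel)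
      \<longlonglongrightarrow> (norm2 lborel G)\<^sup>2"
    by (simp only: tendsto_of_real_iff)
  have lim2: "(\<lambda>n. \<integral>x. exp (- (2 * pi * ?\<sigma> n * x)\<^sup>2 / 2) * (cmod (inv_fourier G x))\<^sup>2 \<partial>lborel)
      \<longlonglongrightarrow> (\<integral>x. (cmod (inv_fourier G x))\<^sup>2 \<partial>lborel)"
  proof (rule integral_dominated_convergence[where w="\<lambda>x. (cmod (inv_fourier G x))\<^sup>2"])
    show "integrable lborel (\<lambda>x. (cmod (inv_fourier G x))\<^sup>2)"
      by (rule Ltwo_integrable[OF inv_fourier_Bessel(1)[OF G]])
    have "(\<lambda>n. exp (- (2 * pi * ?\<sigma> n * x)\<^sup>2 / 2) * (cmod (inv_fourier G x))\<^sup>2) \<longlonglongrightarrow> 1 * (cmod (inv_fourier G x))\<^sup>2" for x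
      by (intro tendsto_mult gaussian_weight_tendsto tendsto_const)
    then show "AE x in lborel. (\<lambda>n. exp (- (2 * pi * ?\<sigma> n * x)\<^sup>2 / 2) * (cmod (inv_fourier G x))\<^sup>2) \<longlonglongrightarrow> (cmod (inv_fourier G x))\<^sup>2"
      by simp
    show "AE x in lborel. norm (exp (- (2 * pi * ?\<sigma> n * x)\<^sup>2 / 2) * (cmod (inv_fourier G x))\<^sup>2) \<le> (cmod (inv_fourier G x))\<^sup>2" for n
      by (intro AE_I2) (simp add: abs_mult mult_left_le_one_le)
  qed measurable
  have "(norm2 lborel (inv_fourier G))\<^sup>2 = (norm2 lborel G)\<^sup>2"
    unfolding norm2_squared[of _ "inv_fourier G"] by (rule LIMSEQ_unique[OF lim2 lim1])
  then show ?thesis by (rule power2_eq_imp_eq) auto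
qed

section \<open>Density of continuous functions and the general Plancherel theorem\<close>

lemma norm2_dominated_convergence:
  assumes [measurable]: "\<And>n. F n \<in> borel_measurable M" "f \<in> borel_measurable M"
    and w: "integrable M w"
    and lim: "AE x in M. (\<lambda>n. F n x) \<longlonglongrightarrow> f x"
    and bound: "\<And>n. AE x in M. (cmod (F n x - f x))\<^sup>2 \<le> w x"
  shows "(\<lambda>n. norm2 M (\<lambda>x. F n x - f x)) \<longlonglongrightarrow> 0"
proof -
  have "(\<lambda>n. \<integral>x. (cmod (F n x - f x))\<^sup>2 \<partial>M) \<longlonglongrightarrow> (\<integral>x. 0 \<partial>M)"
  proof (rule integral_dominated_convergence[OF _ _ w])
    show "AE x in M. (\<lambda>n. (cmod (F n x - f x))\<^sup>2) \<longlonglongrightarrow> 0"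
      using lim
    proof (rule AE_mp, intro AE_I2 impI)
      fix x assume "(\<lambda>n. F n x) \<longlonglongrightarrow> f x"
      then have "(\<lambda>n. (cmod (F n x - f x))\<^sup>2) \<longlonglongrightarrow> (cmod (f x - f x))\<^sup>2"
        by (intro tendsto_intros)
      then show "(\<lambda>n. (cmod (F n x - f x))\<^sup>2) \<longlonglongrightarrow> 0" by simp
    qed
    show "AE x in M. norm ((cmod (F n x - f x))\<^sup>2) \<le> w x" for n
      using bound[of n] by simp
  qed measurable
  then have "(\<lambda>n. sqrt (\<integral>x. (cmod (F n x - f x))\<^sup>2 \<partial>M)) \<longlonglongrightarrow> sqrt 0"
    by (intro tendsto_real_sqrt) simp
  then show ?thesis by (simp add: norm2_def)
qed

lemma Ltwo_truncation:
  assumes G: "G \<in> Ltwo lborel" and e: "e > 0"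
  shows "\<exists>m::nat. norm2 lborel (\<lambda>x::real. (if \<bar>x\<bar> \<le> m \<and> cmod (G x) \<le> m then G x else 0) - G x) < e"
proof -
  have [measurable]: "G \<in> borel_measurable borel" using Ltwo_measurable[OF G] by simp
  have "(\<lambda>m::nat. norm2 lborel (\<lambda>x. (if \<bar>x\<bar> \<le> m \<and> cmod (G x) \<le> m then G x else 0) - G x)) \<longlonglongrightarrow> 0"
  proof (rule norm2_dominated_convergence[OF _ _ Ltwo_integrable[OF G]])
    show "AE x in lborel. (\<lambda>m::nat. if \<bar>x\<bar> \<le> m \<and> cmod (G x) \<le> m then G x else 0) \<longlonglongrightarrow> G x"
    proof (intro AE_I2 tendsto_eventually)
      fix x
      obtain m :: nat where m: "max \<bar>x\<bar> (cmod (G x)) \<le> m" using real_arch_simple by blast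
      show "\<forall>\<^sub>F m::nat in sequentially. (if \<bar>x\<bar> \<le> m \<and> cmod (G x) \<le> m then G x else 0) = G x"
        by (rule eventually_sequentiallyI[of m]) (use m in auto)
    qed
    show "AE x in lborel. (cmod ((if \<bar>x\<bar> \<le> real m \<and> cmod (G x) \<le> m then G x else 0) - G x))\<^sup>2 \<le> (cmod (G x))\<^sup>2" for m :: nat
      by (intro AE_I2) auto
  qed measurable
  then have "\<forall>\<^sub>F m::nat in sequentially. norm2 lborel (\<lambda>x. (if \<bar>x\<bar> \<le> m \<and> cmod (G x) \<le> m then G x else 0) - G x) < e"
    using e by (rule order_tendstoD)
  then show ?thesis by (auto simp: eventually_sequentially)
qed

text \<open>A measurable function is an almost everywhere limit of continuous ones. Clipping their
  values and tapering their support keeps them continuous, does not disturb the limit, and gives a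
  constant majorant on a bounded interval.\<close>

lemma bounded_approx_continuous:
  fixes f :: "real \<Rightarrow> complex"
  assumes [measurable]: "f \<in> borel_measurable borel" and bound: "\<And>x. cmod (f x) \<le> m"
    and supp: "\<And>x. \<bar>x\<bar> > m \<Longrightarrow> f x = 0" and m: "m > 0" and e: "e > 0"
  shows "\<exists>g. continuous_on UNIV g \<and> (\<forall>x. \<bar>x\<bar> > m + 1 \<longrightarrow> g x = 0) \<and> norm2 lborel (\<lambda>x. g x - f x) < e"
proof -
  have "f \<in> borel_measurable lebesgue"
    by (rule measurable_completion) simp
  then have "f measurable_on UNIV" by (rule lebesgue_measurable_imp_measurable_on) auto
  then obtain N h where N: "negligible N" and h: "\<And>n. continuous_on UNIV (h n)"
    and lim: "\<And>x. x \<notin> N \<Longrightarrow> (\<lambda>n. h n x) \<longlonglongrightarrow> f x"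
    by (auto simp: measurable_on_def)
  have AE: "AE x in lborel. (\<lambda>n. h n x) \<longlonglongrightarrow> f x"
  proof -
    have "AE x in lebesgue. x \<notin> N" using N by (intro AE_not_in) (simp add: negligible_iff_null_sets)
    then have "AE x in lborel. x \<notin> N" by (simp add: AE_completion_iff)
    then show ?thesis using lim by (auto elim!: AE_mp)
  qed
  \<comment> \<open>The radial retraction onto the disc of radius \<open>m\<close>; it fixes all
    values of \<open>f\<close>.\<close>
  define clip where "clip z = complex_of_real (m / max m (cmod z)) * z" for z
  have clip: "cmod (clip z) \<le> m" for z
    using m by (auto simp: clip_def norm_mult norm_divide max_def field_simps)
  have clip_eq: "clip z = z" if "cmod z \<le> m" for z
    using m that by (simp add: clip_def max_def)
  have clip_cont: "continuous_on UNIV clip"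
    unfolding clip_def using m by (intro continuous_intros) auto
  \<comment> \<open>A trapezoid equal to 1 where \<open>f\<close> may be nonzero and falling to 0
    over one more unit.\<close>
  define \<psi> where "\<psi> x = max 0 (min 1 (m + 1 - \<bar>x\<bar>))" for x :: real
  have \<psi>: "0 \<le> \<psi> x" "\<psi> x \<le> 1" "\<bar>x\<bar> \<le> m \<Longrightarrow> \<psi> x = 1" "\<bar>x\<bar> > m + 1 \<Longrightarrow> \<psi> x = 0" for x
    by (auto simp: \<psi>_def)
  have \<psi>_cont: "continuous_on UNIV \<psi>" unfolding \<psi>_def by (intro continuous_intros)
  define g where "g n x = complex_of_real (\<psi> x) * clip (h n x)" for n x
  have g_cont: "continuous_on UNIV (g n)" for n
    unfolding g_def using h[of n] \<psi>_cont 
    by (intro continuous_on_mult continuous_on_of_real continuous_on_compose2[OF clip_cont]) auto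
  have [measurable]: "g n \<in> borel_measurable borel" for n using g_cont by (rule borel_measurable_continuous_onI)
  have g_supp: "g n x = 0" if "\<bar>x\<bar> > m + 1" for n x using \<psi>(4)[OF that] by (simp add: g_def)
  have g_bound: "cmod (g n x) \<le> m" for n x
    using clip[of "h n x"] \<psi>(1,2)[of x] m mult_mono[of "\<psi> x" 1 "cmod (clip (h n x))" m] by (simp add: g_def norm_mult)
  have "(\<lambda>n. norm2 lborel (\<lambda>x. g n x - f x)) \<longlonglongrightarrow> 0"
  proof (rule norm2_dominated_convergence)
    show "integrable lborel (\<lambda>x. (2 * m)\<^sup>2 * indicator {- (m + 1)..m + 1} x :: real)"
      by (intro integrable_mult_right integrable_real_indicator) (auto simp: emeasure_lborel_Icc_eq)
    show "AE x in lborel. (\<lambda>n. g n x) \<longlonglongrightarrow> f x"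
      using AE
    proof (rule AE_mp, intro AE_I2 impI)
      fix x assume "(\<lambda>n. h n x) \<longlonglongrightarrow> f x"
      then have "(\<lambda>n. clip (h n x)) \<longlonglongrightarrow> clip (f x)"
        using continuous_on_tendsto_compose[OF clip_cont] by auto
      then have "(\<lambda>n. g n x) \<longlonglongrightarrow> complex_of_real (\<psi> x) * clip (f x)"
        unfolding g_def by (intro tendsto_intros)
      also have "complex_of_real (\<psi> x) * clip (f x) = f x"
        using supp[of x] \<psi>(3)[of x] clip_eq[OF bound[of x]] by (cases "\<bar>x\<bar> \<le> m") auto
      finally show "(\<lambda>n. g n x) \<longlonglongrightarrow> f x" .
    qed
    have "(cmod (g n x - f x))\<^sup>2 \<le> (2 * m)\<^sup>2 * indicator {- (m + 1)..m + 1} x" for n x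
    proof (cases "x \<in> {- (m + 1)..m + 1}")
      case True
      have "cmod (g n x - f x) \<le> 2 * m"
        using norm_triangle_ineq4[of "g n x" "f x"] g_bound[of n x] bound[of x] by simp
      from power_mono[OF this norm_ge_zero, of 2] show ?thesis using True by simp
    next
      case False
      then have "\<bar>x\<bar> > m + 1" by auto
      then show ?thesis using False g_supp[of x n] supp[of x] by simp
    qed
    then show "AE x in lborel. (cmod (g n x - f x))\<^sup>2 \<le> (2 * m)\<^sup>2 * indicator {- (m + 1)..m + 1} x" for n
      by simp
  qed measurable
  then have "\<forall>\<^sub>F n in sequentially. norm2 lborel (\<lambda>x. g n x - f x) < e"
    using e by (rule order_tendstoD)
  then obtain n where "norm2 lborel (\<lambda>x. g n x - f x) < e" by (auto simp: eventually_sequentially)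
  then show ?thesis using g_cont g_supp by blast
qed

lemma Ltwo_approx_continuous:
  assumes G: "G \<in> Ltwo lborel" and e: "e > 0"
  shows "\<exists>g L. continuous_on UNIV g \<and> (\<forall>x::real. \<bar>x\<bar> > L \<longrightarrow> g x = 0) \<and> norm2 lborel (\<lambda>x. g x - G x) < e"
proof -
  have [measurable]: "G \<in> borel_measurable borel" using Ltwo_measurable[OF G] by simp
  obtain m :: nat where m: "norm2 lborel (\<lambda>x. (if \<bar>x\<bar> \<le> m \<and> cmod (G x) \<le> m then G x else 0) - G x) < e / 2"
    using Ltwo_truncation[OF G, of "e / 2"] e by auto
  define f where "f x = (if \<bar>x\<bar> \<le> m \<and> cmod (G x) \<le> m then G x else 0)" for x :: real
  have f_meas[measurable]: "f \<in> borel_measurable borel" unfolding f_def by measurable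
  have f: "f \<in> Ltwo lborel" by (rule Ltwo_AE_bound(1)[OF G]) (auto simp: f_def)
  \<comment> \<open>The first \<open>+ 1\<close> makes the bound positive even for
    \<open>m = 0\<close>; the second is the width of the taper.\<close>
  obtain g where g: "continuous_on UNIV g" "\<forall>x. \<bar>x\<bar> > real m + 1 + 1 \<longrightarrow> g x = 0" "norm2 lborel (\<lambda>x. g x - f x) < e / 2"
  proof -
    have "cmod (f x) \<le> real m + 1" "\<bar>x\<bar> > real m + 1 \<Longrightarrow> f x = 0" for x by (auto simp: f_def)
    then show ?thesis
      using bounded_approx_continuous[OF f_meas, of "real m + 1" "e / 2"] e that by auto
  qed
  have "g \<in> Ltwo lborel" using continuous_compact_support(3)[OF g(1,2)] .
  then have "norm2 lborel (\<lambda>x. g x - G x) < e"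
    using norm2_diff_triangle[OF _ f G, of g] g(3) m by (simp add: f_def[symmetric])
  then show ?thesis using g(1,2) by blast
qed

text \<open>Only the lower estimate remains after Bessel. The error \<open>e / 2\<close> of a
  continuous approximation enters twice: in comparing the functions, and, by Bessel for the
  difference, in comparing their transforms.\<close>

theorem Plancherel:
  assumes G: "integrable lborel G" "G \<in> Ltwo lborel"
  shows "norm2 lborel (inv_fourier G) = norm2 lborel G"
proof (rule antisym[OF inv_fourier_Bessel(2)[OF G]], rule field_le_epsilon)
  fix e :: real assume "e > 0"
  then obtain g L where g: "continuous_on UNIV g" "\<forall>x. \<bar>x\<bar> > L \<longrightarrow> g x = 0"
    and close: "norm2 lborel (\<lambda>x. g x - G x) < e / 2"
    using Ltwo_approx_continuous[OF G(2), of "e / 2"] by auto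
  note gi = continuous_compact_support(2,3)[OF g]
  have d: "integrable lborel (\<lambda>x. g x - G x)" "(\<lambda>x. g x - G x) \<in> Ltwo lborel"
    using G gi by (auto intro: Ltwo_diff)
  have "norm2 lborel G \<le> norm2 lborel g + norm2 lborel (\<lambda>x. g x - G x)"
    using norm2_triangle[OF gi(2) Ltwo_diff[OF G(2) gi(2)]] by (simp add: norm2_minus_commute[of _ G])
  also have "norm2 lborel g = norm2 lborel (inv_fourier g)"
    using Plancherel_continuous[OF g] by simp
  also have "\<dots> \<le> norm2 lborel (inv_fourier G) + norm2 lborel (inv_fourier (\<lambda>x. g x - G x))"
    using norm2_triangle[OF inv_fourier_Bessel(1)[OF G] inv_fourier_Bessel(1)[OF d]] gi(1) G(1)
    by (simp add: inv_fourier_diff)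
  also have "norm2 lborel (inv_fourier (\<lambda>x. g x - G x)) \<le> norm2 lborel (\<lambda>x. g x - G x)"
    by (rule inv_fourier_Bessel(2)[OF d])
  finally show "norm2 lborel G \<le> norm2 lborel (inv_fourier G) + e" using close by simp
qed

section \<open>Mean-square Fourier inversion\<close>

lemma cmod_diff_squared: "(cmod (a - b))\<^sup>2 = (cmod a)\<^sup>2 + (cmod b)\<^sup>2 - 2 * Re (a * cnj b)"
  unfolding cmod_power2 by (simp add: power2_eq_square algebra_simps)

text \<open>Expand the square of the norm. Plancherel for the truncated transform gives the squared
  norm of \<open>F\<close>, and Fubini gives the inner product of \<open>F\<close> with
  \<open>G\<close>; both are the energy of the transform on \<open>{-r..r}\<close>. The error is
  thus the energy of \<open>G\<close> minus the energy captured so far, which Plancherel for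
  \<open>G\<close> sends to 0.\<close>

lemma truncated_Fourier_inversion:
  fixes r :: real
  assumes G: "integrable lborel G" "G \<in> Ltwo lborel"
  defines "F \<equiv> \<lambda>\<nu>. \<integral>x\<in>{-r..r}. inv_fourier G x * cis (- 2 * pi * x * \<nu>) \<partial>lborel"
  shows "F \<in> Ltwo lborel"
    and "(norm2 lborel (\<lambda>\<nu>. F \<nu> - G \<nu>))\<^sup>2 = 
      (norm2 lborel G)\<^sup>2 - (\<integral>x. indicator {-r..r} x * (cmod (inv_fourier G x))\<^sup>2 \<partial>lborel)"
proof -
  note [measurable] = borel_measurable_integrable[OF G(1)]
  define P where "P x = indicator {-r..r} x *\<^sub>R inv_fourier G x" for x
  have [measurable]: "P \<in> borel_measurable borel" unfolding P_def by measurable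
  have P2: "P \<in> Ltwo lborel"
    by (rule Ltwo_AE_bound(1)[OF inv_fourier_Bessel(1)[OF G]]) (auto simp: P_def indicator_def)
  have "integrable lborel (\<lambda>x. (\<integral>\<nu>. cmod (G \<nu>) \<partial>lborel) * indicator {-r..r} x :: real)"
    by (intro integrable_mult_right integrable_real_indicator) (auto simp: emeasure_lborel_Icc_eq)
  then have P1: "integrable lborel P"
  proof (rule Bochner_Integration.integrable_bound)
    have "cmod (P x) \<le> norm ((\<integral>\<nu>. cmod (G \<nu>) \<partial>lborel) * indicator {-r..r} x :: real)" for x
      using order_trans[OF cmod_inv_fourier_le[of G x] abs_ge_self] by (simp add: P_def indicator_def)
    then show "AE x in lborel. cmod (P x) \<le> norm ((\<integral>\<nu>. cmod (G \<nu>) \<partial>lborel) * indicator {-r..r} x :: real)"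
      by simp
  qed measurable
  \<comment> \<open>The forward transform is the inverse one reflected, and reflection preserves
    integrals; the affine form matches the substitution rule.\<close>
  have F: "F \<nu> = inv_fourier P (0 + (-1) * \<nu>)" for \<nu>
    unfolding F_def inv_fourier_def[of P] set_lebesgue_integral_def P_def 
    by (intro Bochner_Integration.integral_cong) (auto simp: mult_ac)
  have "integrable lborel (\<lambda>\<nu>. (cmod (inv_fourier P (0 + (-1) * \<nu>)))\<^sup>2)"
    by (rule lborel_integrable_real_affine[OF Ltwo_integrable[OF inv_fourier_Bessel(1)[OF P1 P2]]]) simp
  then show F2: "F \<in> Ltwo lborel" unfolding Ltwo_def F[abs_def] by simp
  have "(norm2 lborel F)\<^sup>2 = (\<integral>x. (cmod (inv_fourier P x))\<^sup>2 \<partial>lborel)"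
    unfolding norm2_squared F
    using lborel_integral_real_affine[of "-1" "\<lambda>x. (cmod (inv_fourier P x))\<^sup>2" 0] by simp
  also have "\<dots> = (norm2 lborel P)\<^sup>2" using Plancherel[OF P1 P2] by (simp add: norm2_squared[symmetric])
  also have "\<dots> = (\<integral>x. indicator {-r..r} x * (cmod (inv_fourier G x))\<^sup>2 \<partial>lborel)" (is "_ = ?E")
    unfolding norm2_squared by (intro Bochner_Integration.integral_cong) (auto simp: P_def indicator_def)
  finally have normF: "(norm2 lborel F)\<^sup>2 = ?E" .
  have cnj_phi: "cnj (inv_fourier G x) = (\<integral>\<nu>. cnj (G \<nu>) * cis (- 2 * pi * x * \<nu>) \<partial>lborel)" for x
    unfolding inv_fourier_def Bochner_Integration.integral_cnj[symmetric] by (simp add: cis_cnj)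
  have "inner2 lborel F G = (\<integral>\<nu>. cnj (G \<nu>) * (\<integral>x. P x * cis (- 2 * pi * x * \<nu>) \<partial>lborel) \<partial>lborel)"
    unfolding inner2_def F_def set_lebesgue_integral_def P_def by (simp add: mult_ac)
  also have "\<dots> = (\<integral>x. P x * (\<integral>\<nu>. cnj (G \<nu>) * cis (- 2 * pi * x * \<nu>) \<partial>lborel) \<partial>lborel)"
    by (rule integral_kernel_swap[where C=1]) (use G P1 in auto)
  also have "\<dots> = (\<integral>x. complex_of_real (indicator {-r..r} x * (cmod (inv_fourier G x))\<^sup>2) \<partial>lborel)"
    unfolding cnj_phi[symmetric] P_def
    by (intro Bochner_Integration.integral_cong) (auto simp: indicator_def complex_norm_square simp del: of_real_power)
  finally have inner: "inner2 lborel F G = complex_of_real ?E" by (simp only: integral_complex_of_real)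
  have "(norm2 lborel (\<lambda>\<nu>. F \<nu> - G \<nu>))\<^sup>2 = (\<integral>\<nu>. (cmod (F \<nu>))\<^sup>2 + (cmod (G \<nu>))\<^sup>2 - 2 * Re (F \<nu> * cnj (G \<nu>)) \<partial>lborel)"
    unfolding norm2_squared cmod_diff_squared ..
  also have "\<dots> = (norm2 lborel F)\<^sup>2 + (norm2 lborel G)\<^sup>2 - 2 * (\<integral>\<nu>. Re (F \<nu> * cnj (G \<nu>)) \<partial>lborel)"
    using Ltwo_integrable[OF F2] Ltwo_integrable[OF G(2)] Ltwo_mult_cnj_integrable[OF F2 G(2)]
    by (simp add: norm2_squared integrable_Re del: times_complex.simps complex_Re_numeral)
  also have "(\<integral>\<nu>. Re (F \<nu> * cnj (G \<nu>)) \<partial>lborel) = Re (inner2 lborel F G)"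
    unfolding inner2_def by (rule integral_Re[OF Ltwo_mult_cnj_integrable[OF F2 G(2)]])
  finally show "(norm2 lborel (\<lambda>\<nu>. F \<nu> - G \<nu>))\<^sup>2 = (norm2 lborel G)\<^sup>2 - ?E"
    by (simp add: inner normF)
qed

section \<open>Uniqueness of the Hilbert-Schmidt kernel\<close>

text \<open>Products of Borel sets form an intersection-stable generator, and equality of the
  integrals passes to complements and disjoint countable unions, hence to every Borel set of the
  plane.\<close>

lemma AE_eq_if_rectangle_integrals_eq:
  fixes f g :: "real \<times> real \<Rightarrow> complex"
  assumes f: "integrable lborel f" and g: "integrable lborel g"
    and eq: "\<And>a b. a \<in> sets borel \<Longrightarrow> b \<in> sets borel \<Longrightarrow> (\<integral>z\<in>a \<times> b. f z \<partial>lborel) = (\<integral>z\<in>a \<times> b. g z \<partial>lborel)"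
  shows "AE z in lborel. f z = g z"
proof (rule sigma_finite_measure.density_unique_banach[OF sigma_finite_lborel f g])
  let ?G = "{a \<times> b | a b. a \<in> sets (borel :: real measure) \<and> b \<in> sets (borel :: real measure)}"
  have int: "set_integrable lborel A h" if "A \<in> sets lborel" "integrable lborel h" for A and h :: "real \<times> real \<Rightarrow> complex"
    unfolding set_integrable_def using that by (intro integrable_mult_indicator)
  have sets: "sets (lborel :: (real \<times> real) measure) = sigma_sets UNIV ?G"
    unfolding sets_lborel borel_prod[symmetric] sets_pair_measure by simp
  have in_sets: "A \<in> sets lborel" if "A \<in> sigma_sets UNIV ?G" for A
    using that by (simp only: sets)
  fix A :: "(real \<times> real) set" assume "A \<in> sets lborel"
  then have "A \<in> sigma_sets UNIV ?G" unfolding sets .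
  then show "(\<integral>z\<in>A. f z \<partial>lborel) = (\<integral>z\<in>A. g z \<partial>lborel)"
  proof (induct rule: sigma_sets_induct_disjoint[OF Int_stable_pair_measure_generator subset_Pow_Union[THEN order_trans, OF Pow_mono[OF subset_UNIV]], consumes 1, case_names basic empty compl union])
    case (basic A) then show ?case using eq by auto
  next
    case empty show ?case by (simp add: set_lebesgue_integral_def)
  next
    case (compl A)
    have A: "A \<in> sets lborel" using compl(1) by (rule in_sets)
    then have A': "UNIV - A \<in> sets lborel" using sets.compl_sets[OF A] by simp
    have "(\<integral>z\<in>UNIV. h z \<partial>lborel) = (\<integral>z\<in>A. h z \<partial>lborel) + (\<integral>z\<in>UNIV - A. h z \<partial>lborel)"
      if "integrable lborel h" for h :: "real \<times> real \<Rightarrow> complex"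
      using set_integral_Un[OF _ int[OF A that] int[OF A' that]] by simp
    from this[OF f] this[OF g] eq[of UNIV UNIV] compl show ?case by simp
  next
    case (union A)
    have A: "A i \<in> sets lborel" for i by (rule in_sets) (use union(2) in auto)
    then have U: "(\<Union>i. A i) \<in> sets lborel" by (intro sets.countable_UN) blast
    have "(\<integral>z\<in>(\<Union>i. A i). h z \<partial>lborel) = (\<Sum>i. \<integral>z\<in>A i. h z \<partial>lborel)"
      if "integrable lborel h" for h :: "real \<times> real \<Rightarrow> complex"
      using union(1) by (intro lebesgue_integral_countable_add A int[OF U that]) (auto simp: disjoint_family_on_def)
    from this[OF f] this[OF g] union show ?case by simp
  qed
qed

lemma indicator_Ltwo:
  assumes "A \<in> sets M" "emeasure M A < \<infinity>"
  shows "indicator A \<in> Ltwo M"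
proof -
  have "integrable M (indicator A :: _ \<Rightarrow> real)"
    by (rule integrable_real_indicator[OF assms])
  moreover have "(\<lambda>z. (cmod (indicator A z))\<^sup>2) = indicator A"
    by (auto simp: indicator_def)
  moreover have "(indicator A :: _ \<Rightarrow> complex) \<in> borel_measurable M"
    using assms by (intro borel_measurable_indicator)
  ultimately show ?thesis unfolding Ltwo_def by simp
qed

lemma Ltwo_integrable_on_finite:
  assumes f: "f \<in> Ltwo M" and A: "A \<in> sets M" "emeasure M A < \<infinity>"
  shows "integrable M (\<lambda>z. indicator A z *\<^sub>R f z)"
proof -
  have [measurable]: "f \<in> borel_measurable M" "A \<in> sets M" using Ltwo_measurable[OF f] A by auto
  have "(\<lambda>z. complex_of_real (indicator A z)) \<in> Ltwo M"
  proof -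
    have "(cmod (complex_of_real (indicator A z)))\<^sup>2 = indicator A z" for z by (auto simp: indicator_def)
    then show ?thesis using A by (simp add: Ltwo_def)
  qed
  from Ltwo_mult_cnj_integrable[OF f this] show ?thesis
    by (simp add: scaleR_conv_of_real mult.commute)
qed

text \<open>The inner integral is the operator with kernel \<open>\<kappa>\<close> applied to the
  indicator of \<open>b\<close>, so the operator determines the integrals of its kernel over
  rectangles with sides of finite measure.\<close>

lemma Ltwo_rectangle_integral:
  fixes a b :: "real set"
  assumes \<kappa>: "\<kappa> \<in> Ltwo lborel" and [measurable]: "a \<in> sets borel" "b \<in> sets borel"
    and fin: "emeasure lborel a < \<infinity>" "emeasure lborel b < \<infinity>"
  shows "integrable lborel (\<lambda>z. indicator (a \<times> b) z *\<^sub>R \<kappa> z)"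
    and "(\<integral>z\<in>a \<times> b. \<kappa> z \<partial>lborel) = (\<integral>x. indicator a x *\<^sub>R (\<integral>t. \<kappa> (x, t) * indicator b t \<partial>lborel) \<partial>lborel)"
proof -
  have m: "\<kappa> \<in> borel_measurable lborel" using \<kappa> by measurable
  then have [measurable]: "\<kappa> \<in> borel_measurable (borel \<Otimes>\<^sub>M borel)" by (simp add: borel_prod)
  have ab: "a \<times> b \<in> sets lborel" by (simp add: borel_Times)
  have "emeasure lborel (a \<times> b) = emeasure lborel a * emeasure lborel b"
    unfolding lborel_prod[symmetric] by (rule lborel.emeasure_pair_measure_Times) auto
  then have "emeasure lborel (a \<times> b) < \<infinity>" using fin by (simp add: ennreal_mult_less_top)
  then show int: "integrable lborel (\<lambda>z. indicator (a \<times> b) z *\<^sub>R \<kappa> z)"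
    by (intro Ltwo_integrable_on_finite[OF \<kappa> ab])
  have "(\<integral>z\<in>a \<times> b. \<kappa> z \<partial>lborel) = (\<integral>x. \<integral>t. indicator (a \<times> b) (x, t) *\<^sub>R \<kappa> (x, t) \<partial>lborel \<partial>lborel)"
    unfolding set_lebesgue_integral_def
    using lborel_pair.integral_fst'[of "\<lambda>z. indicator (a \<times> b) z *\<^sub>R \<kappa> z"] int by (simp add: lborel_prod)
  also have "\<dots> = (\<integral>x. indicator a x *\<^sub>R (\<integral>t. \<kappa> (x, t) * indicator b t \<partial>lborel) \<partial>lborel)"
  proof (rule Bochner_Integration.integral_cong[OF refl])
    fix x
    have "(\<integral>t. indicator (a \<times> b) (x, t) *\<^sub>R \<kappa> (x, t) \<partial>lborel) = (\<integral>t. indicator a x *\<^sub>R (\<kappa> (x, t) * indicator b t) \<partial>lborel)"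
      by (intro Bochner_Integration.integral_cong) (auto simp: indicator_def)
    then show "(\<integral>t. indicator (a \<times> b) (x, t) *\<^sub>R \<kappa> (x, t) \<partial>lborel) = indicator a x *\<^sub>R (\<integral>t. \<kappa> (x, t) * indicator b t \<partial>lborel)"
      by simp
  qed
  finally show "(\<integral>z\<in>a \<times> b. \<kappa> z \<partial>lborel) = (\<integral>x. indicator a x *\<^sub>R (\<integral>t. \<kappa> (x, t) * indicator b t \<partial>lborel) \<partial>lborel)" .
qed

text \<open>Integrals over rectangles inside a bounded square agree for both kernels. The squares
  \<open>I n \<times> I n\<close> are there because a square-integrable kernel may fail to be
  integrable on the plane; countably many of them cover it. The null set in \<open>x\<close> may
  vary with the test function, since only integrals over \<open>x\<close> are compared.\<close>

lemma has_hs_kernel_unique: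
  assumes "has_hs_kernel H \<kappa>" "has_hs_kernel H \<kappa>'"
  shows "AE z in lborel. \<kappa> z = \<kappa>' z"
proof -
  have \<kappa>: "\<kappa> \<in> Ltwo lborel" "\<kappa>' \<in> Ltwo lborel" using assms by (auto simp: has_hs_kernel_def)
  then have "\<kappa> \<in> borel_measurable lborel" "\<kappa>' \<in> borel_measurable lborel" by measurable
  then have [measurable]: "\<kappa> \<in> borel_measurable (borel \<Otimes>\<^sub>M borel)" "\<kappa>' \<in> borel_measurable (borel \<Otimes>\<^sub>M borel)"
    by (simp_all add: borel_prod)
  define I where "I n = {- real n..real n}" for n
  have fin: "emeasure lborel (A \<inter> I n) < \<infinity>" if "A \<in> sets borel" for A :: "real set" and n
  proof -
    have "emeasure lborel (A \<inter> I n) \<le> emeasure lborel (I n)" using that by (intro emeasure_mono) (auto simp: I_def)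
    also have "\<dots> < \<infinity>" by (auto simp: I_def emeasure_lborel_Icc_eq)
    finally show ?thesis .
  qed
  have "AE z in lborel. indicator (I n \<times> I n) z *\<^sub>R \<kappa> z = indicator (I n \<times> I n) z *\<^sub>R \<kappa>' z" for n
  proof (rule AE_eq_if_rectangle_integrals_eq)
    show "integrable lborel (\<lambda>z. indicator (I n \<times> I n) z *\<^sub>R \<kappa> z)" "integrable lborel (\<lambda>z. indicator (I n \<times> I n) z *\<^sub>R \<kappa>' z)"
      using fin[of UNIV n] by (auto intro!: Ltwo_rectangle_integral(1) \<kappa> simp: I_def)
    fix a b :: "real set" assume ab: "a \<in> sets borel" "b \<in> sets borel"
    have *: "(\<integral>z\<in>a \<times> b. indicator (I n \<times> I n) z *\<^sub>R k z \<partial>lborel) = (\<integral>z\<in>(a \<inter> I n) \<times> (b \<inter> I n). k z \<partial>lborel)" for k :: "real \<times> real \<Rightarrow> complex"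
      unfolding set_lebesgue_integral_def
      by (intro Bochner_Integration.integral_cong) (auto simp: indicator_def)
    have [measurable]: "a \<inter> I n \<in> sets borel" "b \<inter> I n \<in> sets borel" using ab by (auto simp: I_def)
    have "indicator (b \<inter> I n) \<in> Ltwo lborel"
      by (rule indicator_Ltwo) (use fin[OF ab(2)] in auto)
    then have "AE x in lborel. H (indicator (b \<inter> I n)) x = (\<integral>t. \<kappa> (x, t) * indicator (b \<inter> I n) t \<partial>lborel)"
      "AE x in lborel. H (indicator (b \<inter> I n)) x = (\<integral>t. \<kappa>' (x, t) * indicator (b \<inter> I n) t \<partial>lborel)"
      using assms by (auto simp: has_hs_kernel_def)
    then have "AE x in lborel. (\<integral>t. \<kappa> (x, t) * indicator (b \<inter> I n) t \<partial>lborel) = (\<integral>t. \<kappa>' (x, t) * indicator (b \<inter> I n) t \<partial>lborel)"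
      by eventually_elim simp
    then have "(\<integral>x. indicator (a \<inter> I n) x *\<^sub>R (\<integral>t. \<kappa> (x, t) * indicator (b \<inter> I n) t \<partial>lborel) \<partial>lborel) =
      (\<integral>x. indicator (a \<inter> I n) x *\<^sub>R (\<integral>t. \<kappa>' (x, t) * indicator (b \<inter> I n) t \<partial>lborel) \<partial>lborel)"
      by (intro integral_cong_AE) auto
    then show "(\<integral>z\<in>a \<times> b. indicator (I n \<times> I n) z *\<^sub>R \<kappa> z \<partial>lborel) = (\<integral>z\<in>a \<times> b. indicator (I n \<times> I n) z *\<^sub>R \<kappa>' z \<partial>lborel)"
      unfolding * using Ltwo_rectangle_integral(2)[OF _ _ _ fin[OF ab(1)] fin[OF ab(2)]] \<kappa> by simp
  qed
  then have "AE z in lborel. \<forall>n. indicator (I n \<times> I n) z *\<^sub>R \<kappa> z = indicator (I n \<times> I n) z *\<^sub>R \<kappa>' z"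
    unfolding AE_all_countable by blast
  then show ?thesis
  proof (rule AE_mp, intro AE_I2 impI)
    fix z :: "real \<times> real"
    assume *: "\<forall>n. indicator (I n \<times> I n) z *\<^sub>R \<kappa> z = indicator (I n \<times> I n) z *\<^sub>R \<kappa>' z"
    obtain n :: nat where "max \<bar>fst z\<bar> \<bar>snd z\<bar> \<le> real n" using real_arch_simple by blast
    then have "z \<in> I n \<times> I n" by (cases z) (auto simp: I_def)
    then show "\<kappa> z = \<kappa>' z" using *[rule_format, of n] by simp
  qed
qed

lemma AE_hs_kernel:
  assumes "has_hs_kernel H \<kappa>"
  shows "has_hs_kernel H (hs_kernel H)" and "AE z in lborel. hs_kernel H z = \<kappa> z"
proof -
  show "has_hs_kernel H (hs_kernel H)" unfolding hs_kernel_def by (rule someI[of "has_hs_kernel H", OF assms])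
  then show "AE z in lborel. hs_kernel H z = \<kappa> z" using assms by (rule has_hs_kernel_unique)
qed

section \<open>Operators with prescribed spreading function\<close>

lemma Ltwo_lborel_prod_measurable:
  assumes "f \<in> Ltwo (lborel :: (real \<times> real) measure)"
  shows "f \<in> borel_measurable (borel \<Otimes>\<^sub>M borel)"
  using Ltwo_measurable[OF assms] by (simp add: borel_prod)

lemma nn_integral_lborel_pair:
  assumes "f \<in> borel_measurable (borel \<Otimes>\<^sub>M borel)"
  shows "(\<integral>\<^sup>+z. f z \<partial>(lborel :: (real \<times> real) measure)) = (\<integral>\<^sup>+x. \<integral>\<^sup>+y. f (x, y) \<partial>lborel \<partial>lborel)"
  using lborel.nn_integral_fst[of f lborel] assms by (simp add: lborel_prod borel_prod)

lemma AE_lborel_pair: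
  assumes "AE z in (lborel :: (real \<times> real) measure). P z"
  shows "AE x in lborel. AE y in lborel. P (x, y)"
  by (rule lborel_pair.AE_pair) (use assms in \<open>simp only: lborel_prod\<close>)

lemma AE_Ltwo_slice:
  assumes \<eta>: "\<eta> \<in> Ltwo (lborel :: (real \<times> real) measure)"
  shows "AE t in lborel. (\<lambda>\<nu>. \<eta> (t, \<nu>)) \<in> Ltwo lborel"
proof -
  note [measurable] = Ltwo_lborel_prod_measurable[OF \<eta>]
  have "(\<integral>\<^sup>+t. \<integral>\<^sup>+\<nu>. ennreal ((cmod (\<eta> (t, \<nu>)))\<^sup>2) \<partial>lborel \<partial>lborel) = ennreal ((norm2 lborel \<eta>)\<^sup>2)"
    using nn_integral_lborel_pair[of "\<lambda>z. ennreal ((cmod (\<eta> z))\<^sup>2)"] nn_integral_norm2[OF \<eta>] by simp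
  then have "AE t in lborel. (\<integral>\<^sup>+\<nu>. ennreal ((cmod (\<eta> (t, \<nu>)))\<^sup>2) \<partial>lborel) \<noteq> \<infinity>"
    by (intro nn_integral_PInf_AE) auto
  then show ?thesis
    by (rule AE_mp) (auto simp: Ltwo_iff_nn_integral top.not_eq_extremum)
qed

lemma Ltwo_bounded_support_integrable:
  assumes G: "G \<in> Ltwo lborel" and supp: "\<And>\<nu>::real. \<bar>\<nu>\<bar> > L \<Longrightarrow> G \<nu> = 0"
  shows "integrable lborel G"
proof -
  have "integrable lborel (\<lambda>\<nu>. indicator {-L..L} \<nu> *\<^sub>R G \<nu>)"
    by (rule Ltwo_integrable_on_finite[OF G]) (auto simp: emeasure_lborel_Icc_eq)
  also have "(\<lambda>\<nu>. indicator {-L..L} \<nu> *\<^sub>R G \<nu>) = G"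
    using supp by (auto simp: indicator_def fun_eq_iff abs_le_iff not_le less_minus_iff)
  finally show ?thesis .
qed

definition op_of_kernel :: "(real \<times> real \<Rightarrow> complex) \<Rightarrow> fun_op" where
  "op_of_kernel \<kappa> f x = (\<integral>t. \<kappa> (x, t) * f t \<partial>lborel)"

lemma has_hs_kernel_op_of_kernel: "\<kappa> \<in> Ltwo lborel \<Longrightarrow> has_hs_kernel (op_of_kernel \<kappa>) \<kappa>"
  by (simp add: has_hs_kernel_def op_of_kernel_def)

text \<open>Inverts the passage from kernel to spreading function: the impulse response at
  \<open>(t, x)\<close> is the inverse transform of the slice at \<open>t\<close>, and the kernel at
  \<open>(x, s)\<close> is the impulse response at \<open>(x - s, x)\<close>.\<close>

definition kernel_of_spreading :: "(real \<times> real \<Rightarrow> complex) \<Rightarrow> real \<times> real \<Rightarrow> complex" where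
  "kernel_of_spreading \<eta> = (\<lambda>(x, s). inv_fourier (\<lambda>\<nu>. \<eta> (x - s, \<nu>)) x)"

abbreviation op_of_spreading :: "(real \<times> real \<Rightarrow> complex) \<Rightarrow> fun_op" where
  "op_of_spreading \<eta> \<equiv> op_of_kernel (kernel_of_spreading \<eta>)"

section \<open>Spreading functions of bounded bandwidth\<close>

context
  fixes \<eta> :: "real \<times> real \<Rightarrow> complex" and L :: real
  assumes \<eta>: "\<eta> \<in> Ltwo lborel" and supp: "\<And>t \<nu>. \<bar>\<nu>\<bar> > L \<Longrightarrow> \<eta> (t, \<nu>) = 0"
begin

lemma prescribed_spreading_measurable [measurable]: "\<eta> \<in> borel_measurable (borel \<Otimes>\<^sub>M borel)"
  by (rule Ltwo_lborel_prod_measurable[OF \<eta>])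

lemma AE_slice:
  "AE t in lborel. (\<lambda>\<nu>. \<eta> (t, \<nu>)) \<in> Ltwo lborel \<and> integrable lborel (\<lambda>\<nu>. \<eta> (t, \<nu>))"
  using AE_Ltwo_slice[OF \<eta>]
proof (rule AE_mp, intro AE_I2 impI)
  fix t assume *: "(\<lambda>\<nu>. \<eta> (t, \<nu>)) \<in> Ltwo lborel"
  show "(\<lambda>\<nu>. \<eta> (t, \<nu>)) \<in> Ltwo lborel \<and> integrable lborel (\<lambda>\<nu>. \<eta> (t, \<nu>))"
    using Ltwo_bounded_support_integrable[OF *] supp * by auto
qed

lemma kernel_of_spreading_measurable [measurable]:
  "kernel_of_spreading \<eta> \<in> borel_measurable (borel \<Otimes>\<^sub>M borel)"
  unfolding kernel_of_spreading_def by measurable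

text \<open>For fixed \<open>x\<close> the substitution \<open>t = x - s\<close> preserves the
  integral; Tonelli then exposes the slices at fixed \<open>t\<close>, where Plancherel applies. The
  isometry is what makes \<open>hs_norm\<close> computable from \<open>\<eta>\<close>.\<close>

lemma kernel_of_spreading_Ltwo:
  shows "kernel_of_spreading \<eta> \<in> Ltwo lborel"
    and "norm2 lborel (kernel_of_spreading \<eta>) = norm2 lborel \<eta>"
proof -
  let ?h = "\<lambda>t x. inv_fourier (\<lambda>\<nu>. \<eta> (t, \<nu>)) x"
  have "(\<integral>\<^sup>+z. ennreal ((cmod (kernel_of_spreading \<eta> z))\<^sup>2) \<partial>lborel) = 
      (\<integral>\<^sup>+x. \<integral>\<^sup>+s. ennreal ((cmod (?h (x + (-1) * s) x))\<^sup>2) \<partial>lborel \<partial>lborel)"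
    by (subst nn_integral_lborel_pair) (auto simp: kernel_of_spreading_def)
  also have "\<dots> = (\<integral>\<^sup>+x. \<integral>\<^sup>+t. ennreal ((cmod (?h t x))\<^sup>2) \<partial>lborel \<partial>lborel)"
  proof (rule nn_integral_cong)
    fix x
    show "(\<integral>\<^sup>+s. ennreal ((cmod (?h (x + (-1) * s) x))\<^sup>2) \<partial>lborel) = (\<integral>\<^sup>+t. ennreal ((cmod (?h t x))\<^sup>2) \<partial>lborel)"
      by (subst (2) nn_integral_real_affine[where c="-1" and t=x]) auto
  qed
  also have "\<dots> = (\<integral>\<^sup>+t. \<integral>\<^sup>+x. ennreal ((cmod (?h t x))\<^sup>2) \<partial>lborel \<partial>lborel)"
    by (rule lborel_pair.Fubini') measurable
  also have "\<dots> = (\<integral>\<^sup>+t. \<integral>\<^sup>+\<nu>. ennreal ((cmod (\<eta> (t, \<nu>)))\<^sup>2) \<partial>lborel \<partial>lborel)"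
  proof (rule nn_integral_cong_AE, use AE_slice in \<open>rule AE_mp\<close>, intro AE_I2 impI)
    fix t assume t: "(\<lambda>\<nu>. \<eta> (t, \<nu>)) \<in> Ltwo lborel \<and> integrable lborel (\<lambda>\<nu>. \<eta> (t, \<nu>))"
    then show "(\<integral>\<^sup>+x. ennreal ((cmod (?h t x))\<^sup>2) \<partial>lborel) = (\<integral>\<^sup>+\<nu>. ennreal ((cmod (\<eta> (t, \<nu>)))\<^sup>2) \<partial>lborel)"
      using nn_integral_norm2[OF inv_fourier_Bessel(1), of "\<lambda>\<nu>. \<eta> (t, \<nu>)"] nn_integral_norm2[of "\<lambda>\<nu>. \<eta> (t, \<nu>)" lborel]
        Plancherel[of "\<lambda>\<nu>. \<eta> (t, \<nu>)"] by simp
  qed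
  also have "\<dots> = ennreal ((norm2 lborel \<eta>)\<^sup>2)"
    using nn_integral_lborel_pair[of "\<lambda>z. ennreal ((cmod (\<eta> z))\<^sup>2)"] nn_integral_norm2[OF \<eta>] by simp
  finally have eq: "(\<integral>\<^sup>+z. ennreal ((cmod (kernel_of_spreading \<eta> z))\<^sup>2) \<partial>lborel) = ennreal ((norm2 lborel \<eta>)\<^sup>2)" .
  have m: "kernel_of_spreading \<eta> \<in> borel_measurable lborel"
    using kernel_of_spreading_measurable by (simp add: borel_prod)
  show *: "kernel_of_spreading \<eta> \<in> Ltwo lborel"
    using eq by (simp add: Ltwo_iff_nn_integral[OF m])
  show "norm2 lborel (kernel_of_spreading \<eta>) = norm2 lborel \<eta>"
  proof (rule power2_eq_imp_eq)
    show "(norm2 lborel (kernel_of_spreading \<eta>))\<^sup>2 = (norm2 lborel \<eta>)\<^sup>2"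
      using trans[OF nn_integral_norm2[OF *, symmetric] eq] by simp
  qed auto
qed

lemma has_hs_kernel_op_of_spreading: "has_hs_kernel (op_of_spreading \<eta>) (kernel_of_spreading \<eta>)"
  by (rule has_hs_kernel_op_of_kernel[OF kernel_of_spreading_Ltwo(1)])

lemma hs_kernel_op_of_spreading_Ltwo: "hs_kernel (op_of_spreading \<eta>) \<in> Ltwo lborel"
  using AE_hs_kernel(1)[OF has_hs_kernel_op_of_spreading] by (simp add: has_hs_kernel_def)

lemma hs_kernel_op_of_spreading_measurable [measurable]: "hs_kernel (op_of_spreading \<eta>) \<in> borel_measurable (borel \<Otimes>\<^sub>M borel)"
  by (rule Ltwo_lborel_prod_measurable[OF hs_kernel_op_of_spreading_Ltwo])

lemma hs_norm_op_of_spreading: "hs_norm (op_of_spreading \<eta>) = norm2 lborel \<eta>"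
  unfolding hs_norm_def kernel_of_spreading_Ltwo(2)[symmetric]
  by (rule norm2_cong_AE[OF Ltwo_measurable[OF hs_kernel_op_of_spreading_Ltwo] Ltwo_measurable[OF kernel_of_spreading_Ltwo(1)] AE_hs_kernel(2)[OF has_hs_kernel_op_of_spreading]])

text \<open>The chosen kernel differs from the intended one on a null set of the plane. For almost
  every \<open>x\<close> this is a null set in \<open>s\<close>, which the reflection
  \<open>s = x - t\<close> carries to a null set in \<open>t\<close>; measurability then allows the
  two quantifiers to be exchanged.\<close>

lemma AE_impulse_response:
  "AE t in lborel. AE x in lborel. impulse_response (op_of_spreading \<eta>) t x = inv_fourier (\<lambda>\<nu>. \<eta> (t, \<nu>)) x"
proof -
  have "AE x in lborel. AE s in lborel. hs_kernel (op_of_spreading \<eta>) (x, s) = kernel_of_spreading \<eta> (x, s)"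
    by (rule AE_lborel_pair[OF AE_hs_kernel(2)[OF has_hs_kernel_op_of_spreading]])
  then have "AE x in lborel. AE t in lborel. impulse_response (op_of_spreading \<eta>) t x = inv_fourier (\<lambda>\<nu>. \<eta> (t, \<nu>)) x"
  proof eventually_elim
    case (elim x)
    then have "AE t in lborel. hs_kernel (op_of_spreading \<eta>) (x, x + (-1) * t) = kernel_of_spreading \<eta> (x, x + (-1) * t)"
      by (intro AE_borel_affine[where c="-1"]) auto
    then show "AE t in lborel. impulse_response (op_of_spreading \<eta>) t x = inv_fourier (\<lambda>\<nu>. \<eta> (t, \<nu>)) x"
      by (simp add: impulse_response_def kernel_of_spreading_def)
  qed
  then show ?thesis
    unfolding impulse_response_def
    by (rule iffD1[OF lborel_pair.AE_commute, rotated]) measurable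
qed

text \<open>On almost every slice the squared inversion error lies between 0 and the energy of the
  slice and tends to 0. The slice energies have a finite integral over \<open>t\<close>, so
  dominated convergence in \<open>t\<close> gives convergence on the plane.\<close>

lemma has_spreading_op_of_spreading: "has_spreading (op_of_spreading \<eta>) \<eta>"
proof -
  define F where "F n = (\<lambda>(t, \<nu>). \<integral>x\<in>{- real n..real n}. impulse_response (op_of_spreading \<eta>) t x * cis (- 2 * pi * x * \<nu>) \<partial>lborel)" for n :: nat
  have [measurable]: "F n \<in> borel_measurable (borel \<Otimes>\<^sub>M borel)" for n
    unfolding F_def set_lebesgue_integral_def impulse_response_def by measurable
  then have Fm: "F n \<in> borel_measurable lborel" for n by (simp add: borel_prod)
  define u where "u n t = (\<integral>\<^sup>+\<nu>. ennreal ((cmod (F n (t, \<nu>) - \<eta> (t, \<nu>)))\<^sup>2) \<partial>lborel)" for n t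
  define w where "w t = (\<integral>\<^sup>+\<nu>. ennreal ((cmod (\<eta> (t, \<nu>)))\<^sup>2) \<partial>lborel)" for t
  have w_int: "(\<integral>\<^sup>+t. w t \<partial>lborel) = ennreal ((norm2 lborel \<eta>)\<^sup>2)"
    unfolding w_def using nn_integral_lborel_pair[of "\<lambda>z. ennreal ((cmod (\<eta> z))\<^sup>2)"] nn_integral_norm2[OF \<eta>] by simp
  have "AE t in lborel. (\<forall>n. u n t \<le> w t) \<and> (\<lambda>n. u n t) \<longlonglongrightarrow> 0"
    using AE_slice AE_impulse_response
  proof eventually_elim
    case (elim t)
    let ?G = "\<lambda>\<nu>. \<eta> (t, \<nu>)"
    have G: "integrable lborel ?G" "?G \<in> Ltwo lborel" using elim by auto
    let ?E = "\<lambda>n. \<integral>x. indicator {-real n..real n} x * (cmod (inv_fourier ?G x))\<^sup>2 \<partial>lborel"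
    \<comment> \<open>For this \<open>t\<close> the chosen impulse response is wrong only on a null
      set of \<open>x\<close>, so the truncated integrals agree at every
      \<open>\<nu>\<close>.\<close>
    have F: "F n (t, \<nu>) = (\<integral>x\<in>{- real n..real n}. inv_fourier ?G x * cis (- 2 * pi * x * \<nu>) \<partial>lborel)" for n \<nu>
      unfolding F_def prod.case set_lebesgue_integral_def
    proof (rule integral_cong_AE)
      show "AE x in lborel. indicat_real {- real n..real n} x *\<^sub>R (impulse_response (op_of_spreading \<eta>) t x * cis (- 2 * pi * x * \<nu>)) =
         indicat_real {- real n..real n} x *\<^sub>R (inv_fourier ?G x * cis (- 2 * pi * x * \<nu>))"
        using elim(2) by eventually_elim simp
    qed (unfold impulse_response_def, measurable)
    note inv = truncated_Fourier_inversion[OF G, where r="real n" for n, folded F]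
    have u: "u n t = ennreal ((norm2 lborel ?G)\<^sup>2 - ?E n)" for n
      unfolding u_def inv(2)[symmetric] by (rule nn_integral_norm2[OF Ltwo_diff[OF inv(1) G(2)]])
    have E0: "0 \<le> ?E n" for n by (rule Bochner_Integration.integral_nonneg) auto
    have w: "w t = ennreal ((norm2 lborel ?G)\<^sup>2)"
      unfolding w_def by (rule nn_integral_norm2[OF G(2)])
    have le: "u n t \<le> w t" for n unfolding u w using E0[of n] by (intro ennreal_leI) simp
    have "?E \<longlonglongrightarrow> (\<integral>x. (cmod (inv_fourier ?G x))\<^sup>2 \<partial>lborel)"
    proof (rule integral_dominated_convergence[OF _ _ Ltwo_integrable[OF inv_fourier_Bessel(1)[OF G]]])
      show "AE x in lborel. (\<lambda>n. indicator {-real n..real n} x * (cmod (inv_fourier ?G x))\<^sup>2) \<longlonglongrightarrow> (cmod (inv_fourier ?G x))\<^sup>2"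
      proof (intro AE_I2 tendsto_eventually)
        fix x :: real
        obtain m :: nat where "\<bar>x\<bar> \<le> real m" using real_arch_simple by blast
        then show "\<forall>\<^sub>F n in sequentially. indicator {-real n..real n} x * (cmod (inv_fourier ?G x))\<^sup>2 = (cmod (inv_fourier ?G x))\<^sup>2"
          by (intro eventually_sequentiallyI[of m]) (auto simp: indicator_def)
      qed
      show "AE x in lborel. norm (indicator {-real n..real n} x * (cmod (inv_fourier ?G x))\<^sup>2) \<le> (cmod (inv_fourier ?G x))\<^sup>2" for n
        by (intro AE_I2) (auto simp: indicator_def)
    qed measurable
    also have "(\<integral>x. (cmod (inv_fourier ?G x))\<^sup>2 \<partial>lborel) = (norm2 lborel ?G)\<^sup>2"
      unfolding norm2_squared[symmetric] Plancherel[OF G] ..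
    finally have "(\<lambda>n. (norm2 lborel ?G)\<^sup>2 - ?E n) \<longlonglongrightarrow> (norm2 lborel ?G)\<^sup>2 - (norm2 lborel ?G)\<^sup>2"
      by (intro tendsto_intros)
    then have "(\<lambda>n. u n t) \<longlonglongrightarrow> ennreal 0" unfolding u by (intro tendsto_ennrealI) simp
    then show ?case using le by simp
  qed
  then have AE_u: "\<And>n. AE t in lborel. u n t \<le> w t" "AE t in lborel. (\<lambda>n. u n t) \<longlonglongrightarrow> 0" by auto
  have "(\<lambda>n. \<integral>\<^sup>+t. u n t \<partial>lborel) \<longlonglongrightarrow> (\<integral>\<^sup>+t. 0 \<partial>(lborel :: real measure))"
    by (rule nn_integral_dominated_convergence[OF _ _ _ AE_u(1) _ AE_u(2)])
       (auto simp: w_int, auto simp: u_def w_def)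
  then have lim: "(\<lambda>n. \<integral>\<^sup>+t. u n t \<partial>lborel) \<longlonglongrightarrow> 0" by simp
  have u_int: "(\<integral>\<^sup>+z. ennreal ((cmod (F n z - \<eta> z))\<^sup>2) \<partial>lborel) = (\<integral>\<^sup>+t. u n t \<partial>lborel)" for n
    unfolding u_def by (subst nn_integral_lborel_pair) auto
  have "(\<integral>\<^sup>+t. u n t \<partial>lborel) \<le> (\<integral>\<^sup>+t. w t \<partial>lborel)" for n by (rule nn_integral_mono_AE[OF AE_u(1)])
  then have fin: "(\<integral>\<^sup>+t. u n t \<partial>lborel) < \<infinity>" for n unfolding w_int by (rule le_less_trans) simp
  \<comment> \<open>The error is shown to be square-integrable first; membership of
    \<open>F n\<close> follows by adding \<open>\<eta>\<close>.\<close>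
  have diff: "(\<lambda>z. F n z - \<eta> z) \<in> Ltwo lborel" for n
    using fin[of n] Fm[of n] Ltwo_measurable[OF \<eta>] by (subst Ltwo_iff_nn_integral) (auto simp: u_int)
  have F2: "F n \<in> Ltwo lborel" for n using Ltwo_add[OF diff[of n] \<eta>] by simp
  have "(\<lambda>n. ennreal ((norm2 lborel (\<lambda>z. F n z - \<eta> z))\<^sup>2)) \<longlonglongrightarrow> 0"
    using lim unfolding u_int[symmetric] nn_integral_norm2[OF diff] .
  then have "(\<lambda>n. (norm2 lborel (\<lambda>z. F n z - \<eta> z))\<^sup>2) \<longlonglongrightarrow> 0" by (simp add: ennreal_tendsto_0_iff)
  then have "(\<lambda>n. norm2 lborel (\<lambda>z. F n z - \<eta> z)) \<longlonglongrightarrow> 0"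
    using tendsto_real_sqrt[of "\<lambda>n. (norm2 lborel (\<lambda>z. F n z - \<eta> z))\<^sup>2" 0 sequentially] by simp
  then have "Ltwo_tendsto lborel F \<eta>" using F2 \<eta> by (simp add: Ltwo_tendsto_def)
  then show ?thesis unfolding has_spreading_def F_def .
qed

lemma spreading_op_of_spreading:
  shows "spreading (op_of_spreading \<eta>) \<in> Ltwo lborel" and "AE z in lborel. spreading (op_of_spreading \<eta>) z = \<eta> z"
proof -
  have *: "has_spreading (op_of_spreading \<eta>) (spreading (op_of_spreading \<eta>))"
    unfolding spreading_def by (rule someI[of "has_spreading (op_of_spreading \<eta>)", OF has_spreading_op_of_spreading])
  then show "spreading (op_of_spreading \<eta>) \<in> Ltwo lborel" by (simp add: has_spreading_def Ltwo_tendsto_def)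
  show "AE z in lborel. spreading (op_of_spreading \<eta>) z = \<eta> z"
    using * has_spreading_op_of_spreading unfolding has_spreading_def by (rule Ltwo_limit_unique)
qed

text \<open>The exceptional set involves \<open>t\<close> only: slices equal almost everywhere in
  \<open>\<nu>\<close> have the same inverse transform at every \<open>x\<close>. This uniformity is
  essential, since the response evaluates along lines \<open>(x - \<Lambda> k, x)\<close>, which are
  null sets of the plane.\<close>

lemma AE_impulse_response_cont:
  "AE t in lborel. \<forall>x. impulse_response_cont (op_of_spreading \<eta>) t x = inv_fourier (\<lambda>\<nu>. \<eta> (t, \<nu>)) x"
  using AE_lborel_pair[OF spreading_op_of_spreading(2)]
proof eventually_elim
  case (elim t)
  note [measurable] = Ltwo_lborel_prod_measurable[OF spreading_op_of_spreading(1)]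
  show ?case
    unfolding impulse_response_cont_def inv_fourier_def
    by (intro allI integral_cong_AE) (use elim in auto)
qed

text \<open>The complement of \<open>S\<close> is an open set on which the spreading function
  vanishes almost everywhere, so no point of it lies in the essential support.\<close>

lemma op_of_spreading_in_OPW:
  assumes S: "closed S" "\<And>z. z \<notin> S \<Longrightarrow> \<eta> z = 0"
  shows "op_of_spreading \<eta> \<in> OPW S"
proof -
  have "ess_support (spreading (op_of_spreading \<eta>)) \<subseteq> S"
  proof
    fix z assume z: "z \<in> ess_support (spreading (op_of_spreading \<eta>))"
    have "AE w in lborel. w \<in> - S \<longrightarrow> spreading (op_of_spreading \<eta>) w = 0"
      using spreading_op_of_spreading(2) by eventually_elim (use S in auto)
    then show "z \<in> S" using z S(1) by (auto simp: ess_support_def open_Compl)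
  qed
  then show ?thesis using has_hs_kernel_op_of_spreading by (auto simp: OPW_def HS_def)
qed

end

section \<open>Sampling with a Riesz basis of exponentials\<close>

lemma AE_lborel_shift:
  assumes "AE t in lborel. P t"
  shows "AE x in lborel. P (x - a :: real)"
proof -
  obtain N where N: "N \<in> null_sets lborel" "{t. \<not> P t} \<subseteq> N"
    using assms by (auto simp: eventually_ae_filter)
  have [measurable]: "N \<in> sets borel" using N(1) by auto
  have "AE x in lborel. - a + 1 * x \<notin> N"
    by (rule AE_borel_affine) (use AE_not_in[OF N(1)] in auto)
  then show ?thesis by (rule AE_mp) (use N(2) in auto)
qed

lemma not_AE_notin_interval:
  fixes a b :: real
  assumes "a < b" shows "\<not> (AE x in lborel. x \<notin> {a..b})"
proof
  assume "AE x in lborel. x \<notin> {a..b}"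
  then have "{a..b} \<in> null_sets lborel" by (subst AE_iff_null_sets) auto
  then show False using assms by (auto simp: null_sets_def)
qed

lemma Ltwo_tensor:
  assumes u: "u \<in> Ltwo lborel" and G: "G \<in> Ltwo lborel"
  shows "(\<lambda>(t, \<nu>). u t * G \<nu>) \<in> Ltwo (lborel :: (real \<times> real) measure)"
proof -
  have [measurable]: "u \<in> borel_measurable borel" "G \<in> borel_measurable borel"
    using Ltwo_measurable[OF u] Ltwo_measurable[OF G] by auto
  have m: "(\<lambda>(t, \<nu>). u t * G \<nu>) \<in> borel_measurable (borel \<Otimes>\<^sub>M borel)" by measurable
  then have m': "(\<lambda>(t, \<nu>). u t * G \<nu>) \<in> borel_measurable lborel" by (simp add: borel_prod)
  have "(\<integral>\<^sup>+z. ennreal ((cmod (case z of (t, \<nu>) \<Rightarrow> u t * G \<nu>))\<^sup>2) \<partial>lborel)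
    = (\<integral>\<^sup>+t. \<integral>\<^sup>+\<nu>. ennreal ((cmod (u t * G \<nu>))\<^sup>2) \<partial>lborel \<partial>lborel)"
    by (subst nn_integral_lborel_pair) (auto intro: m)
  also have "\<dots> = (\<integral>\<^sup>+t. ennreal ((cmod (u t))\<^sup>2) \<partial>lborel) * (\<integral>\<^sup>+\<nu>. ennreal ((cmod (G \<nu>))\<^sup>2) \<partial>lborel)"
    by (simp add: norm_mult power_mult_distrib ennreal_mult nn_integral_cmult nn_integral_multc)
  also have "\<dots> < \<infinity>" by (simp add: nn_integral_norm2 u G ennreal_mult_less_top)
  finally show ?thesis by (simp add: Ltwo_iff_nn_integral[OF m'])
qed

text \<open>Extend the dual vector of index \<open>j\<close> by zero. Conjugating the exponentials
  turns its frame coefficients into point values of its inverse transform, so this transform is a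
  band-limited function that interpolates a unit impulse on the nodes.\<close>

lemma exponential_riesz_basis_interpolation:
  assumes "riesz_basis (restrict_space lborel {a..b}) UNIV (\<lambda>(k::int) \<xi>. cis (- 2 * pi * \<Lambda> k * \<xi>))"
  shows "\<exists>G\<in>Ltwo lborel. (\<forall>\<nu>. \<nu> \<notin> {a..b} \<longrightarrow> G \<nu> = 0) \<and> (\<forall>k. inv_fourier G (\<Lambda> k) = (if k = j then 1 else 0))"
proof -
  let ?R = "restrict_space (lborel :: real measure) {a..b}"
  obtain g where g: "g \<in> Ltwo ?R" 
    and bi: "\<And>k. inner2 ?R g (\<lambda>\<xi>. cis (- 2 * pi * \<Lambda> k * \<xi>)) = (if k = j then 1 else 0)"
    using riesz_basis_biorthogonal[OF assms, of j] by auto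
  define G where "G \<nu> = indicator {a..b} \<nu> *\<^sub>R g \<nu>" for \<nu>
  have "G \<in> borel_measurable lborel"
    unfolding G_def using iffD1[OF borel_measurable_restrict_space_iff Ltwo_measurable[OF g]] by simp
  moreover have "integrable lborel (\<lambda>\<nu>. (cmod (G \<nu>))\<^sup>2)"
  proof -
    have "integrable lborel (\<lambda>\<nu>. indicator {a..b} \<nu> *\<^sub>R (cmod (g \<nu>))\<^sup>2)"
      using iffD1[OF integrable_restrict_space Ltwo_integrable[OF g]] by simp
    also have "(\<lambda>\<nu>. indicator {a..b} \<nu> *\<^sub>R (cmod (g \<nu>))\<^sup>2) = (\<lambda>\<nu>. (cmod (G \<nu>))\<^sup>2)"
      by (auto simp: G_def indicator_def)
    finally show ?thesis .
  qed
  ultimately have "G \<in> Ltwo lborel" unfolding Ltwo_def by blast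
  moreover have "inv_fourier G (\<Lambda> k) = (if k = j then 1 else 0)" for k
  proof -
    have "inner2 ?R g (\<lambda>\<xi>. cis (- 2 * pi * \<Lambda> k * \<xi>)) = (\<integral>\<nu>. indicator {a..b} \<nu> *\<^sub>R (g \<nu> * cnj (cis (- 2 * pi * \<Lambda> k * \<nu>))) \<partial>lborel)"
      unfolding inner2_def by (rule integral_restrict_space) auto
    also have "\<dots> = inv_fourier G (\<Lambda> k)"
      by (simp add: inv_fourier_def G_def cis_cnj)
    finally show ?thesis using bi[of k] by simp
  qed
  moreover have "\<forall>\<nu>. \<nu> \<notin> {a..b} \<longrightarrow> G \<nu> = 0" by (simp add: G_def)
  ultimately show ?thesis by blast
qed

text \<open>
  Modulating by \<open>cis (- 2 * pi * t * \<nu>)\<close> turns the sample at \<open>t + y\<close> of the slice at \<open>t\<close> into the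
  sample of \<open>G\<close> at \<open>y\<close>.
\<close>
definition modulated :: "(real \<Rightarrow> complex) \<Rightarrow> (real \<Rightarrow> complex) \<Rightarrow> real \<times> real \<Rightarrow> complex" where
  "modulated u G = (\<lambda>(t, \<nu>). u t * G \<nu> * cis (- 2 * pi * t * \<nu>))"

lemma modulated_Ltwo:
  assumes "u \<in> Ltwo lborel" "G \<in> Ltwo lborel"
  shows "modulated u G \<in> Ltwo lborel"
proof (rule Ltwo_AE_bound(1)[OF Ltwo_tensor[OF assms]])
  have [measurable]: "u \<in> borel_measurable borel" "G \<in> borel_measurable borel"
    using Ltwo_measurable[OF assms(1)] Ltwo_measurable[OF assms(2)] by auto
  have "modulated u G \<in> borel_measurable (borel \<Otimes>\<^sub>M borel)" unfolding modulated_def by measurable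
  then show "modulated u G \<in> borel_measurable lborel" by (simp add: borel_prod)
  show "AE z in lborel. cmod (modulated u G z) \<le> cmod (case z of (t, \<nu>) \<Rightarrow> u t * G \<nu>)"
    by (auto simp: modulated_def norm_mult)
qed

lemma inv_fourier_modulated:
  assumes "integrable lborel F" "integrable lborel G"
  shows "inv_fourier (\<lambda>\<nu>. modulated u F (t, \<nu>) + modulated v G (t, \<nu>)) (t + y)
    = u t * inv_fourier F y + v t * inv_fourier G y"
proof -
  have eq: "(modulated u F (t, \<nu>) + modulated v G (t, \<nu>)) * cis (2 * pi * (t + y) * \<nu>)
    = u t * (F \<nu> * cis (2 * pi * y * \<nu>)) + v t * (G \<nu> * cis (2 * pi * y * \<nu>))" for \<nu>
  proof -
    have "cis (- 2 * pi * t * \<nu>) * cis (2 * pi * (t + y) * \<nu>) = cis (2 * pi * y * \<nu>)"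
      by (simp add: cis_mult algebra_simps)
    then show ?thesis by (simp add: modulated_def distrib_right mult.assoc)
  qed
  show ?thesis
    unfolding inv_fourier_def eq using assms by (simp add: integrable_mult_cis)
qed

section \<open>Cancellation of two overlapping response terms\<close>

theorem theorem4p8:
  fixes T \<Omega> :: real and \<Lambda> :: "int \<Rightarrow> real"
  assumes "T > 0" and "\<Omega> > 0"
    and "\<And>k. \<Lambda> (k + 1) > \<Lambda> k"
    and "set_of_sampling \<Lambda> (OPW ({0..T} \<times> {- \<Omega> / 2..\<Omega> / 2}))"
    and "riesz_basis (restrict_space lborel {- \<Omega> / 2..\<Omega> / 2}) UNIV
           (\<lambda>k \<xi>. cis (- 2 * pi * \<Lambda> k * \<xi>))"
  shows "\<forall>k. \<Lambda> (k + 1) - \<Lambda> k \<ge> T"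
proof (rule ccontr)
  assume "\<not> (\<forall>k. \<Lambda> (k + 1) - \<Lambda> k \<ge> T)"
  then obtain i where i: "\<Lambda> (i + 1) - \<Lambda> i < T" by (auto simp: not_le)
  define d where "d = \<Lambda> (i + 1) - \<Lambda> i"
  have d: "0 < d" "d < T" using i assms(3)[of i] by (auto simp: d_def)
  let ?I = "{- \<Omega> / 2..\<Omega> / 2}" and ?S = "{0..T} \<times> {- \<Omega> / 2..\<Omega> / 2}"
  obtain c where "identifies (\<lambda>H. response H c \<Lambda>) (OPW ?S)"
    using assms(4) by (auto simp: set_of_sampling_def)
  then obtain m where m: "m > 0"
    and R: "\<And>H. H \<in> OPW ?S \<Longrightarrow> response H c \<Lambda> \<in> Ltwo lborel \<and> m * hs_norm H \<le> norm2 lborel (response H c \<Lambda>)"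
    unfolding identifies_def by blast
  obtain G0 where G0: "G0 \<in> Ltwo lborel" "\<And>\<nu>. \<nu> \<notin> ?I \<Longrightarrow> G0 \<nu> = 0" "\<And>k. inv_fourier G0 (\<Lambda> k) = (if k = i then 1 else 0)"
    using exponential_riesz_basis_interpolation[OF assms(5), of i] by blast
  obtain G1 where G1: "G1 \<in> Ltwo lborel" "\<And>\<nu>. \<nu> \<notin> ?I \<Longrightarrow> G1 \<nu> = 0" "\<And>k. inv_fourier G1 (\<Lambda> k) = (if k = i + 1 then 1 else 0)"
    using exponential_riesz_basis_interpolation[OF assms(5), of "i + 1"] by blast
  have out: "\<nu> \<notin> ?I" if "\<bar>\<nu>\<bar> > \<Omega> / 2" for \<nu>
    using that by auto
  have int: "integrable lborel G0" "integrable lborel G1"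
    by (rule Ltwo_bounded_support_integrable[OF G0(1), of "\<Omega> / 2"], rule G0(2), erule out)
       (rule Ltwo_bounded_support_integrable[OF G1(1), of "\<Omega> / 2"], rule G1(2), erule out)
  \<comment> \<open>One homogeneous linear equation in two unknowns has a nontrivial solution:
    \<open>(1, 0)\<close> if \<open>c i\<close> vanishes, and otherwise
    \<open>(c (i + 1), - c i)\<close>.\<close>
  obtain a b where ab: "c i * a + c (i + 1) * b = 0" "a \<noteq> 0 \<or> b \<noteq> 0"
    by (cases "c i = 0") (use that[of 1 0] that[of "c (i + 1)" "- c i"] in auto)
  \<comment> \<open>Both profiles live inside \<open>{0..T}\<close>, and shifting the first by
    \<open>\<Lambda> i\<close> and the second by \<open>\<Lambda> (i + 1)\<close> yields the same
    interval, from \<open>\<Lambda> (i + 1)\<close> to \<open>\<Lambda> i + T\<close>. Its length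
    \<open>T - d\<close> is positive exactly because the gap is smaller than
    \<open>T\<close>.\<close>
  define u where "u t = a * indicator {d..T} t" for t :: real
  define v where "v t = b * indicator {0..T - d} t" for t :: real
  have "indicator {x..y} \<in> Ltwo lborel" for x y :: real
    by (rule indicator_Ltwo) (auto simp: emeasure_lborel_Icc_eq)
  then have uv2: "u \<in> Ltwo lborel" "v \<in> Ltwo lborel"
    unfolding u_def v_def by (auto intro: Ltwo_cmult)
  define \<eta> where "\<eta> z = modulated u G0 z + modulated v G1 z" for z
  have \<eta>: "\<eta> \<in> Ltwo lborel"
    unfolding \<eta>_def by (intro Ltwo_add modulated_Ltwo uv2 G0(1) G1(1))
  have \<eta>_S: "\<eta> z = 0" if "z \<notin> ?S" for z
    using that d G0(2) G1(2) by (cases z) (auto simp: \<eta>_def modulated_def u_def v_def indicator_def)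
  have \<eta>_supp: "\<eta> (t, \<nu>) = 0" if "\<bar>\<nu>\<bar> > \<Omega> / 2" for t \<nu>
    using out[OF that] by (intro \<eta>_S) simp
  have slice: "inv_fourier (\<lambda>\<nu>. \<eta> (t, \<nu>)) (t + \<Lambda> k) = (if k = i then u t else if k = i + 1 then v t else 0)" for t k
    unfolding \<eta>_def inv_fourier_modulated[OF int] by (simp add: G0(3) G1(3))
  define H where "H = op_of_spreading \<eta>"
  have H: "H \<in> OPW ?S"
    unfolding H_def by (rule op_of_spreading_in_OPW[where L="\<Omega> / 2", OF \<eta> \<eta>_supp _ \<eta>_S]) (auto intro: closed_Times)
  \<comment> \<open>Each node shifts the exceptional set of times; countably many shifted null sets
    are still null, so one set of \<open>x\<close> serves the whole sum.\<close>
  have "AE x in lborel. \<forall>k. impulse_response_cont H (x - \<Lambda> k) x = (if k = i then u (x - \<Lambda> k) else if k = i + 1 then v (x - \<Lambda> k) else 0)"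
  proof (subst AE_all_countable, rule allI)
    fix k
    have "AE x in lborel. \<forall>y. impulse_response_cont H (x - \<Lambda> k) y = inv_fourier (\<lambda>\<nu>. \<eta> (x - \<Lambda> k, \<nu>)) y"
      unfolding H_def by (rule AE_lborel_shift[OF AE_impulse_response_cont[OF \<eta> \<eta>_supp]])
    then show "AE x in lborel. impulse_response_cont H (x - \<Lambda> k) x = (if k = i then u (x - \<Lambda> k) else if k = i + 1 then v (x - \<Lambda> k) else 0)"
    proof eventually_elim
      case (elim x)
      then show ?case using slice[of "x - \<Lambda> k" k] by simp
    qed
  qed
  then have "AE x in lborel. response H c \<Lambda> x = 0"
  proof eventually_elim
    case (elim x)
    have "response H c \<Lambda> x = (\<Sum>\<^sub>\<infinity>k\<in>{i, i + 1}. c k * impulse_response_cont H (x - \<Lambda> k) x)"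
      unfolding response_def by (rule infsum_cong_neutral) (use elim in auto)
    also have "\<dots> = c i * u (x - \<Lambda> i) + c (i + 1) * v (x - \<Lambda> (i + 1))"
      using elim by simp
    \<comment> \<open>Since \<open>x - \<Lambda> (i + 1) = (x - \<Lambda> i) - d\<close>, both
      indicators test the same condition on \<open>x\<close>.\<close>
    also have "\<dots> = (c i * a + c (i + 1) * b) * indicator {d..T} (x - \<Lambda> i)"
      by (auto simp: u_def v_def d_def indicator_def algebra_simps)
    finally show ?case using ab(1) by simp
  qed
  moreover have "hs_norm H = norm2 lborel \<eta>"
    unfolding H_def by (rule hs_norm_op_of_spreading[where L="\<Omega> / 2", OF \<eta> \<eta>_supp])
  ultimately have "m * norm2 lborel \<eta> \<le> 0" using R[OF H] norm2_eq_0_iff[of "response H c \<Lambda>" lborel] by simp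
  then have "norm2 lborel \<eta> = 0" using m norm2_nonneg[of lborel \<eta>] by (simp add: mult_le_0_iff)
  then have "AE z in lborel. \<eta> z = 0" using norm2_eq_0_iff[OF \<eta>] by simp
  then have "AE t in lborel. AE \<nu> in lborel. \<eta> (t, \<nu>) = 0" by (rule AE_lborel_pair)
  \<comment> \<open>The samples of a slice recover \<open>u t\<close> and \<open>v t\<close>, so a
    vanishing \<open>\<eta>\<close> kills both profiles, although one of them is a nonzero constant
    on an interval of positive length.\<close>
  then have uv0: "AE t in lborel. u t = 0 \<and> v t = 0"
  proof eventually_elim
    case (elim t)
    have "inv_fourier (\<lambda>\<nu>. \<eta> (t, \<nu>)) y = 0" for y
      unfolding inv_fourier_def by (rule integral_eq_zero_AE) (use elim in auto)
    then show ?case using slice[of t i] slice[of t "i + 1"] by simp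
  qed
  have "AE t in lborel. t \<notin> {d..T}" if "a \<noteq> 0"
    using uv0 by eventually_elim (use that in \<open>auto simp: u_def\<close>)
  moreover have "AE t in lborel. t \<notin> {0..T - d}" if "b \<noteq> 0"
    using uv0 by eventually_elim (use that in \<open>auto simp: v_def\<close>)
  ultimately show False
    using ab(2) d not_AE_notin_interval[of d T] not_AE_notin_interval[of 0 "T - d"] by auto
qed

end
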